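(* The following relation holds (for complex parameters $\gamma$ and $\underline\lambda=(\lambda_1,\ldots,\lambda_{\ell+1})$ for which the integral converges absolutely): for all $\underline{y}=(y_1,\ldots,y_{\ell+1})\in\mathbb{R}^{\ell+1}$, $$\int_{\mathbb{R}^{\ell+1}}\prod_{i=1}^{\ell+1}dx_i\;\mathcal{Q}^{\mathfrak{gl}_{\ell+1}}(\underline{y},\underline{x}|\gamma)\,\Psi^{\mathfrak{gl}_{\ell+1}}_{\underline{\lambda}}(\underline{x})=\prod_{i=1}^{\ell+1}\Gamma(\imath\gamma-\imath\lambda_i)\;\Psi^{\mathfrak{gl}_{\ell+1}}_{\underline{\lambda}}(\underline{y}).$$
   Context: Here $\imath=\sqrt{-1}$. The Baxter operator kernel is $$\mathcal{Q}^{\mathfrak{gl}_{\ell+1}}(\underline{y},\underline{x}|\gamma)=\exp\Big\{\imath\gamma\sum_{i=1}^{\ell+1}(y_i-x_i)-\sum_{k=1}^{\ell}\big(e^{y_k-x_k}+e^{x_k-y_{k+1}}\big)-e^{y_{\ell+1}-x_{\ell+1}}\Big\}.$$ The $\mathfrak{gl}_{\ell+1}$-Whittaker function is given by the Givental integral (with $x_{\ell+1,i}:=x_i$) $$\Psi^{\mathfrak{gl}_{\ell+1}}_{\lambda_1,\ldots,\lambda_{\ell+1}}(x_1,\ldots,x_{\ell+1})=\int_{\mathbb{R}^{\ell(\ell+1)/2}}\prod_{k=1}^{\ell}\prod_{i=1}^k dx_{k,i}\; \exp\Big\{\imath\sum_{k=1}^{\ell+1}\lambda_k\Big(\sum_{i=1}^k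 x_{k,i}-\sum_{i=1}^{k-1}x_{k-1,i}\Big)-\sum_{k=1}^{\ell}\sum_{i=1}^{k}\big(e^{x_{k+1,i}-x_{k,i}}+e^{x_{k,i}-x_{k+1,i+1}}\big)\Big\}.$$ *)

theory Defs
  imports "HOL-Analysis.Analysis"
begin

text \<open>
  Throughout, \<open>l\<close> is the rank, and a point of the Euclidean space of dimension \<open>l + 1\<close> is a
  function \<open>x :: nat \<Rightarrow> real\<close> of which only the values at the indices \<open>1, \<dots>, l + 1\<close> matter.
  Integration over a finite family of real variables is with respect to the product of the
  one-dimensional Lebesgue--Borel measures.
\<close>

abbreviation lborel_Pi :: "'i set \<Rightarrow> ('i \<Rightarrow> real) measure"
  where "lborel_Pi I \<equiv> PiM I (\<lambda>_. lborel)"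

definition baxter_kernel ::
    "nat \<Rightarrow> (nat \<Rightarrow> real) \<Rightarrow> (nat \<Rightarrow> real) \<Rightarrow> complex \<Rightarrow> complex"
  where "baxter_kernel l y x \<gamma> =
    exp (\<i> * \<gamma> * of_real (\<Sum>i=1..l+1. y i - x i)
         - of_real (\<Sum>k=1..l. exp (y k - x k) + exp (x k - y (k+1)))
         - of_real (exp (y (l+1) - x (l+1))))"

text \<open>The index set of the \<open>l (l + 1) / 2\<close> integration variables of the Givental integral.\<close>

definition givental_index :: "nat \<Rightarrow> (nat \<times> nat) set"
  where "givental_index l = (SIGMA k:{1..l}. {1..k})"

text \<open>
  The triangular array whose rows \<open>1, \<dots>, l\<close> are the integration variables \<open>u\<close> and whose
  row \<open>l + 1\<close> is the argument \<open>x\<close> of the Whittaker function.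
\<close>

definition givental_array ::
    "nat \<Rightarrow> (nat \<Rightarrow> real) \<Rightarrow> (nat \<times> nat \<Rightarrow> real) \<Rightarrow> nat \<Rightarrow> nat \<Rightarrow> real"
  where "givental_array l x u k i = (if k = l + 1 then x i else u (k, i))"

text \<open>
  In the summand \<open>k = 1\<close> below, the sum over \<open>{1..k-1}\<close> is empty, so no entry with
  first index \<open>0\<close> occurs.
\<close>

definition givental_integrand ::
    "nat \<Rightarrow> (nat \<Rightarrow> complex) \<Rightarrow> (nat \<Rightarrow> nat \<Rightarrow> real) \<Rightarrow> complex"
  where "givental_integrand l \<Lambda> X =
    exp (\<i> * (\<Sum>k=1..l+1. \<Lambda> k * of_real ((\<Sum>i=1..k. X k i) - (\<Sum>i=1..k-1. X (k-1) i)))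
         - of_real (\<Sum>k=1..l. \<Sum>i=1..k.
             exp (X (k+1) i - X k i) + exp (X k i - X (k+1) (i+1))))"

definition whittaker :: "nat \<Rightarrow> (nat \<Rightarrow> complex) \<Rightarrow> (nat \<Rightarrow> real) \<Rightarrow> complex"
  where "whittaker l \<Lambda> x =
    (LINT u|lborel_Pi (givental_index l). givental_integrand l \<Lambda> (givental_array l x u))"

end

theory Submission
  imports Defs "HOL-Complex_Analysis.Complex_Analysis"
begin

text \<open>
  Write \<open>Q\<^sub>l\<close> for the Baxter kernel, \<open>\<Psi>\<^sub>l\<close> for the Whittaker function, and \<open>K\<^sub>n(\<mu>; x, u)\<close> for the
  factor that the last row of the triangular array contributes to the Givental integrand, so that
  \<open>\<Psi>\<^sub>l\<^sub>+\<^sub>1(x) = \<integral> K\<^sub>l\<^sub>+\<^sub>1(\<Lambda>\<^sub>l\<^sub>+\<^sub>2; x, u) \<Psi>\<^sub>l(u) du\<close> (lemma \<open>whittaker_Suc\<close>).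

  The identity comes from an intertwining relation between the two kernels
  (\<open>baxter_givental_commute\<close>): with \<open>s = \<i>\<gamma> - \<i>\<mu>\<close>,
  \<open>\<integral> Q\<^sub>n(y, x) K\<^sub>n(\<mu>; x, u) dx = \<Gamma>(s) \<integral> K\<^sub>n(\<mu>; y, v) Q\<^sub>n\<^sub>-\<^sub>1(v, u) dv\<close>.
  Neither integrand couples two integration variables, so both sides are products of integrals
  over the line. On the left the variable \<open>x\<^sub>i\<close> has the weight
  \<open>exp (- s x - A\<^sub>i e\<^sup>-\<^sup>x - B\<^sub>i e\<^sup>x)\<close> with \<open>A\<^sub>i = e^(y\<^sub>i) + e^(u\<^sub>i\<^sub>-\<^sub>1)\<close> and
  \<open>B\<^sub>i = e^(- y\<^sub>i\<^sub>+\<^sub>1) + e^(- u\<^sub>i)\<close>; on the right \<open>v\<^sub>i\<close> has the same weight with \<open>- s\<close> for \<open>s\<close>. The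
  reflection \<open>x \<mapsto> ln (A\<^sub>i / B\<^sub>i) - x\<close> exchanges the two. The last variable \<open>x\<^sub>n\<^sub>+\<^sub>1\<close> is not confined from
  above (\<open>B = 0\<close>) and yields the Gamma factor. The powers of \<open>A\<^sub>i / B\<^sub>i\<close> produced by the reflections
  combine with the prefactors because \<open>B\<^sub>i = A\<^sub>i\<^sub>+\<^sub>1 e^(- y\<^sub>i\<^sub>+\<^sub>1 - u\<^sub>i)\<close> makes their product telescope
  (\<open>sum_log_weights\<close>).

  Induction on \<open>l\<close> gives the claim whenever \<open>Re (\<i>\<gamma> - \<i>\<Lambda>\<^sub>j) > 0\<close> for all \<open>j\<close>
  (\<open>baxter_whittaker_half_plane\<close>). The exchanges of integrals are justified by the same induction
  for the absolute values of all integrands, which are again kernels, with purely imaginary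
  parameters (\<open>abs_baxter_whittaker\<close>). The resulting bound is finite because the Givental integral of
  the absolute values grows at most exponentially in the size of \<open>x\<close> (\<open>abs_whittaker_growth\<close>).

  The hypothesis of the theorem is only that the integral converges absolutely at the given
  \<open>\<gamma>\<close>. Extracting \<open>Re (\<i>\<gamma> - \<i>\<Lambda>\<^sub>j) > 0\<close> from this would require the asymptotics of \<open>\<Psi>\<close>.
  Instead, replace \<open>\<i>\<gamma>\<close> by \<open>\<i>\<gamma> + z\<close>: this multiplies the integrand by \<open>e^(z S(x))\<close> with
  \<open>S(x) = \<Sum>\<^sub>i (y\<^sub>i - x\<^sub>i)\<close>. As the integrals converge absolutely for \<open>z = 0\<close> and for all large \<open>Re z\<close>,
  they do so on the whole half-plane \<open>Re z \<ge> 0\<close>, are holomorphic inside it and continuous along the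
  positive axis down to \<open>0\<close>. Hence the identity, known for large \<open>Re z\<close>, extends to \<open>z = 0\<close>
  (\<open>laplace_continuation\<close>).
\<close>

section \<open>Gamma and Bessel integrals over the real line\<close>

text \<open>
  For \<open>A, B > 0\<close> the integral of this function over the line is
  \<open>2 (B / A)^(s / 2) K\<^sub>s(2 sqrt (A B))\<close> with the modified Bessel function \<open>K\<^sub>s\<close>, and for \<open>B = 0\<close> it is a
  Gamma integral.
\<close>

definition bessel_integrand :: "complex \<Rightarrow> real \<Rightarrow> real \<Rightarrow> real \<Rightarrow> complex" where
  "bessel_integrand s A B x = exp (- s * of_real x - of_real (A * exp (-x) + B * exp x))"

lemma bessel_integrand_measurable [measurable]: "bessel_integrand s A B \<in> borel_measurable borel"
  unfolding bessel_integrand_def by measurable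

lemma norm_bessel_integrand:
  "norm (bessel_integrand s A B x) = exp (- Re s * x - (A * exp (-x) + B * exp x))"
  by (simp add: bessel_integrand_def)

text \<open>
  The substitution \<open>t = A e\<^sup>-\<^sup>x\<close> in Euler's integral. The power \<open>A\<^sup>-\<^sup>s\<close> is written as an exponential, the
  form in which it meets the other prefactors later on.
\<close>

lemma integral_bessel_gamma:
  assumes "Re s > 0" "A > 0"
  shows "integrable lborel (bessel_integrand s A 0)"
    and "(LINT x|lborel. bessel_integrand s A 0 x) = Gamma s * exp (- s * of_real (ln A))"
proof -
  define f :: "real \<Rightarrow> complex" where "f = (\<lambda>t. of_real t powr (s - 1) / of_real (exp t))"
  define g where "g = (\<lambda>x. A * exp (- x))"
  have img: "g ` UNIV = {0<..}"
  proof -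
    have "t \<in> range g" if "t > 0" for t
      using that assms by (intro image_eqI[of _ _ "- ln (t / A)"]) (auto simp: g_def exp_minus)
    thus ?thesis using assms by (auto simp: g_def)
  qed
  have "(\<lambda>x. \<bar>- g x\<bar> *\<^sub>R f (g x)) absolutely_integrable_on UNIV \<and>
        integral UNIV (\<lambda>x. \<bar>- g x\<bar> *\<^sub>R f (g x)) = Gamma s
      \<longleftrightarrow> f absolutely_integrable_on (g ` UNIV) \<and> integral (g ` UNIV) f = Gamma s"
    using assms by (intro has_absolute_integral_change_of_variables_real)
      (auto simp: g_def inj_on_def intro!: derivative_eq_intros)
  moreover have "f absolutely_integrable_on {0<..} \<and> integral {0<..} f = Gamma s"
    using absolutely_integrable_Gamma_integral'[of s] Gamma_integral_complex'[of s] assms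
    unfolding f_def by (auto intro: integral_unique)
  ultimately have *: "(\<lambda>x. \<bar>- g x\<bar> *\<^sub>R f (g x)) absolutely_integrable_on UNIV"
    "integral UNIV (\<lambda>x. \<bar>- g x\<bar> *\<^sub>R f (g x)) = Gamma s" by (auto simp: img)
  have eq: "\<bar>- g x\<bar> *\<^sub>R f (g x) = exp (s * of_real (ln A)) * bessel_integrand s A 0 x" for x
  proof -
    have "g x > 0" using assms by (simp add: g_def)
    have "Ln (complex_of_real (g x)) = of_real (ln (g x))"
      using \<open>g x > 0\<close> by (simp add: Ln_of_real)
    moreover have "ln (g x) = ln A - x" using assms by (simp add: g_def ln_mult)
    ultimately have L: "Ln (complex_of_real (g x)) = of_real (ln A - x)" by simp
    have e: "complex_of_real (g x) = exp (of_real (ln A - x))"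
      using \<open>g x > 0\<close> L by (metis exp_Ln of_real_eq_0_iff order_less_irrefl)
    have "\<bar>- g x\<bar> *\<^sub>R f (g x) = of_real (g x) * f (g x)"
      using \<open>g x > 0\<close> by (simp add: scaleR_conv_of_real)
    also have "\<dots> = exp (of_real (ln A - x)) * (exp ((s - 1) * of_real (ln A - x)) / of_real (exp (g x)))"
      using \<open>g x > 0\<close> unfolding f_def powr_def L by (subst e) auto
    also have "\<dots> = exp (s * of_real (ln A)) * bessel_integrand s A 0 x"
      unfolding bessel_integrand_def exp_of_real[symmetric] exp_add[symmetric] exp_diff[symmetric] times_divide_eq_right
      by (rule arg_cong[of _ _ exp]) (simp add: g_def algebra_simps)
    finally show ?thesis .
  qed
  have I: "integrable lborel (\<lambda>x. exp (s * of_real (ln A)) * bessel_integrand s A 0 x)"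
    using *(1) unfolding eq set_integrable_def by (simp add: integrable_completion)
  have *: "(LINT x|lborel. exp (s * of_real (ln A)) * bessel_integrand s A 0 x) = Gamma s"
    using *(2) unfolding eq using I integral_lborel[OF I] by simp
  show "integrable lborel (bessel_integrand s A 0)"
    using integrable_mult_right[OF I, of "exp (- s * of_real (ln A))"]
    by (simp add: mult.assoc[symmetric] exp_add[symmetric])
  then have "exp (s * of_real (ln A)) * (LINT x|lborel. bessel_integrand s A 0 x) = Gamma s" using * by simp
  hence "exp (- s * of_real (ln A)) * (exp (s * of_real (ln A)) * (LINT x|lborel. bessel_integrand s A 0 x))
     = exp (- s * of_real (ln A)) * Gamma s" by simp
  thus "(LINT x|lborel. bessel_integrand s A 0 x) = Gamma s * exp (- s * of_real (ln A))"
    by (simp add: mult.assoc[symmetric] exp_add[symmetric])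
qed

lemma integrable_reflect: 
  fixes f :: "real \<Rightarrow> complex"
  shows "integrable lborel f \<Longrightarrow> integrable lborel (\<lambda>x. f (- x))"
  using lborel_integrable_real_affine[of f "-1" 0] by simp

text \<open>
  The factor \<open>e\<^sup>-\<^sup>s\<^sup>x\<close> can grow at one end of the line only, and which end that is depends on the sign of
  \<open>Re s\<close>. Comparing separately on each half line with the Gamma integrands of exponent
  \<open>r \<ge> \<bar>Re s\<bar>\<close> treats all \<open>s\<close> alike.
\<close>

lemma bessel_integrand_bound:
  assumes "A \<ge> 0" "B \<ge> 0" "\<bar>Re s\<bar> \<le> r"
  shows "norm (bessel_integrand s A B x)
    \<le> norm (bessel_integrand (of_real r) A 0 x) + norm (bessel_integrand (of_real r) B 0 (- x))"
proof (cases "x \<ge> 0")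
  case True
  hence "- Re s * x \<le> r * x" using assms by (intro mult_right_mono) auto
  moreover have "A * exp (-x) \<ge> 0" using assms by simp
  ultimately have "norm (bessel_integrand s A B x) \<le> norm (bessel_integrand (of_real r) B 0 (- x))"
    unfolding norm_bessel_integrand exp_le_cancel_iff Re_complex_of_real minus_minus mult_zero_left by linarith
  thus ?thesis by (simp add: add_increasing)
next
  case False
  hence "Re s * (-x) \<le> r * (-x)" using assms by (intro mult_right_mono) auto
  moreover have "B * exp (x) \<ge> 0" using assms by simp
  ultimately have "norm (bessel_integrand s A B x) \<le> norm (bessel_integrand (of_real r) A 0 x)"
    unfolding norm_bessel_integrand exp_le_cancel_iff Re_complex_of_real mult_zero_left by linarith
  thus ?thesis by (simp add: add_increasing2)
qed

lemma integrable_bessel: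
  assumes "A > 0" "B > 0"
  shows "integrable lborel (bessel_integrand s A B)"
proof -
  define r where "r = \<bar>Re s\<bar> + 1"
  have I: "integrable lborel (bessel_integrand (of_real r) C 0)" if "C > 0" for C
    using that by (intro integral_bessel_gamma) (auto simp: r_def)
  show ?thesis
  proof (rule Bochner_Integration.integrable_bound)
    show "integrable lborel (\<lambda>x. norm (bessel_integrand (of_real r) A 0 x) + norm (bessel_integrand (of_real r) B 0 (- x)))"
      using assms by (intro Bochner_Integration.integrable_add integrable_norm I integrable_reflect) auto
    have "norm (bessel_integrand s A B x) \<le> norm (norm (bessel_integrand (of_real r) A 0 x) + norm (bessel_integrand (of_real r) B 0 (- x)))" for x
      using bessel_integrand_bound[of A B s r x] assms unfolding r_def by (simp)
    thus "AE x in lborel. norm (bessel_integrand s A B x) \<le> norm (norm (bessel_integrand (of_real r) A 0 x) + norm (bessel_integrand (of_real r) B 0 (- x)))" by simp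
  qed simp
qed

text \<open>
  The reflection \<open>x \<mapsto> ln (A / B) - x\<close> exchanges \<open>A e\<^sup>-\<^sup>x\<close> and \<open>B e\<^sup>x\<close>. This is the symmetry
  \<open>K\<^sub>-\<^sub>s = K\<^sub>s\<close> of the Bessel function.
\<close>

lemma bessel_reflection:
  assumes "A > 0" "B > 0"
  shows "(LINT x|lborel. bessel_integrand (- s) A B x)
    = exp (s * of_real (ln A - ln B)) * (LINT x|lborel. bessel_integrand s A B x)"
proof -
  have eq: "bessel_integrand (- s) A B ((ln A - ln B) + (-1) * x)
     = exp (s * of_real (ln A - ln B)) * bessel_integrand s A B x" for x
  proof -
    have "A * exp (- ((ln A - ln B) + (-1) * x)) = B * exp x" 
         "B * exp ((ln A - ln B) + (-1) * x) = A * exp (-x)"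
      using assms by (auto simp: exp_add exp_diff exp_minus field_simps)
    then show ?thesis unfolding bessel_integrand_def
      by (simp only: exp_add[symmetric]) (rule arg_cong[of _ _ exp], simp add: algebra_simps)
  qed
  show ?thesis
    by (subst lborel_integral_real_affine[of "-1" _ "ln A - ln B"]) (simp_all only: eq, simp_all)
qed

text \<open>
  A variable between two neighbours \<open>p\<close> and \<open>q\<close> of the next row: on each side one of the two
  double exponential walls is enough to dominate \<open>e\<^sup>c\<^sup>|\<^sup>u\<^sup>|\<close>.
\<close>

lemma nn_integral_exp_abs_le:
  assumes "c > 0"
  shows "(\<integral>\<^sup>+u. ennreal (exp (c * \<bar>u\<bar> - (exp (p - u) + exp (u - q)))) \<partial>lborel)
     \<le> ennreal (2 * Gamma c * exp (c * (\<bar>p\<bar> + \<bar>q\<bar>)))"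
proof -
  have I: "integrable lborel (\<lambda>u. norm (bessel_integrand (of_real c) (exp z) 0 u))" for z
    using assms by (intro integrable_norm integral_bessel_gamma) auto
  have V: "(LINT u|lborel. norm (bessel_integrand (of_real c) (exp z) 0 u)) = Gamma c * exp (- c * z)" for z
  proof -
    have "bessel_integrand (of_real c) (exp z) 0 u = of_real (norm (bessel_integrand (of_real c) (exp z) 0 u))" for u
      unfolding norm_bessel_integrand exp_of_real[symmetric] by (simp add: bessel_integrand_def)
    hence "(LINT u|lborel. complex_of_real (norm (bessel_integrand (of_real c) (exp z) 0 u)))
        = Gamma (of_real c) * exp (- of_real c * of_real (ln (exp z)))"
      using integral_bessel_gamma(2)[of "of_real c" "exp z"] assms by simp
    also have "\<dots> = complex_of_real (Gamma c * exp (- c * z))"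
      by (simp add: Gamma_complex_of_real exp_of_real[symmetric])
    finally show ?thesis unfolding integral_complex_of_real of_real_eq_iff .
  qed
  have V': "(\<integral>\<^sup>+u. ennreal (norm (bessel_integrand (of_real c) (exp z) 0 u)) \<partial>lborel) = ennreal (Gamma c * exp (- c * z))" for z
    using nn_integral_eq_integral[OF I] V by simp
  have "(\<integral>\<^sup>+u. ennreal (norm (bessel_integrand (of_real c) (exp z) 0 (- u))) \<partial>lborel) = ennreal (Gamma c * exp (- c * z))" for z
    using nn_integral_real_affine[of "\<lambda>u. ennreal (norm (bessel_integrand (of_real c) (exp z) 0 u))" "-1" 0] V' by simp
  note V'' = this
  have "(\<integral>\<^sup>+u. ennreal (exp (c * \<bar>u\<bar> - (exp (p - u) + exp (u - q)))) \<partial>lborel)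
     \<le> (\<integral>\<^sup>+u. (ennreal (norm (bessel_integrand (of_real c) (exp p) 0 u)) + ennreal (norm (bessel_integrand (of_real c) (exp (- q)) 0 (- u)))) \<partial>lborel)"
  proof (rule nn_integral_mono)
    fix u :: real
    have "exp (c * \<bar>u\<bar> - (exp (p - u) + exp (u - q))) \<le> exp (- c * u - exp (p - u)) + exp (c * u - exp (u - q))"
    proof (cases "u \<ge> 0")
      case True
      hence "exp (c * \<bar>u\<bar> - (exp (p - u) + exp (u - q))) \<le> exp (c * u - exp (u - q))" by simp
      thus ?thesis using exp_gt_zero[of "- c * u - exp (p - u)"] by linarith
    next
      case False
      hence "exp (c * \<bar>u\<bar> - (exp (p - u) + exp (u - q))) \<le> exp (- c * u - exp (p - u))" by simp
      thus ?thesis using exp_gt_zero[of "c * u - exp (u - q)"] by linarith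
    qed
    also have "\<dots> = norm (bessel_integrand (of_real c) (exp p) 0 u) + norm (bessel_integrand (of_real c) (exp (- q)) 0 (- u))"
      by (simp add: norm_bessel_integrand exp_add[symmetric] add.commute)
    finally show "ennreal (exp (c * \<bar>u\<bar> - (exp (p - u) + exp (u - q)))) \<le> ennreal (norm (bessel_integrand (of_real c) (exp p) 0 u)) + ennreal (norm (bessel_integrand (of_real c) (exp (- q)) 0 (- u)))"
      by (simp add: ennreal_plus[symmetric] del: ennreal_plus)
  qed
  also have "\<dots> = ennreal (Gamma c * exp (- c * p)) + ennreal (Gamma c * exp (- c * (- q)))"
    by (subst nn_integral_add) (simp_all only: V' V'', simp_all)
  also have "\<dots> = ennreal (Gamma c * exp (- c * p) + Gamma c * exp (- c * (- q)))"
    using assms by (subst ennreal_plus) (auto simp: Gamma_real_pos less_imp_le)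
  also have "\<dots> \<le> ennreal (2 * Gamma c * exp (c * (\<bar>p\<bar> + \<bar>q\<bar>)))"
  proof (rule ennreal_leI)
    have "- c * p \<le> c * (\<bar>p\<bar> + \<bar>q\<bar>)" "- c * (- q) \<le> c * (\<bar>p\<bar> + \<bar>q\<bar>)"
      using mult_left_mono[of "- p" "\<bar>p\<bar> + \<bar>q\<bar>" c] mult_left_mono[of q "\<bar>p\<bar> + \<bar>q\<bar>" c] assms by auto
    hence "exp (- c * p) \<le> exp (c * (\<bar>p\<bar> + \<bar>q\<bar>))" "exp (- c * (- q)) \<le> exp (c * (\<bar>p\<bar> + \<bar>q\<bar>))"
      unfolding exp_le_cancel_iff .
    hence "exp (- c * p) + exp (- c * (- q)) \<le> 2 * exp (c * (\<bar>p\<bar> + \<bar>q\<bar>))" by linarith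
    hence "Gamma c * (exp (- c * p) + exp (- c * (- q))) \<le> Gamma c * (2 * exp (c * (\<bar>p\<bar> + \<bar>q\<bar>)))"
      using assms by (intro mult_left_mono) (auto simp: Gamma_real_pos less_imp_le)
    thus "Gamma c * exp (- c * p) + Gamma c * exp (- c * (- q)) \<le> 2 * Gamma c * exp (c * (\<bar>p\<bar> + \<bar>q\<bar>))"
      by (simp add: algebra_simps)
  qed
  finally show ?thesis .
qed

section \<open>Analytic continuation of a Laplace transform\<close>

context
  fixes M :: "'a measure" and S :: "'a \<Rightarrow> real" and g :: "'a \<Rightarrow> complex" and T :: real
  assumes S_meas [measurable]: "S \<in> borel_measurable M"
    and g_int: "integrable M g"
    and g_exp_int: "\<And>t. t \<ge> T \<Longrightarrow> integrable M (\<lambda>x. of_real (exp (t * S x)) * g x)"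
begin

text \<open>
  For \<open>0 \<le> t \<le> r\<close> the function \<open>e\<^sup>t\<^sup>S\<close> lies below \<open>1 + e\<^sup>r\<^sup>S\<close>, so integrability at both ends of an interval of
  exponents gives it in between. No bound on \<open>S\<close> from either side is available.
\<close>

lemma laplace_weight_integrable:
  assumes "t \<ge> 0"
  shows "integrable M (\<lambda>x. exp (t * S x) * norm (g x))"
proof (rule Bochner_Integration.integrable_bound)
  note [measurable] = borel_measurable_integrable[OF g_int]
  define r where "r = max t T"
  show "integrable M (\<lambda>x. norm (g x) + norm (of_real (exp (r * S x)) * g x))"
    by (intro Bochner_Integration.integrable_add integrable_norm g_int g_exp_int) (simp add: r_def)
  have "exp (t * S x) \<le> 1 + exp (r * S x)" for x
  proof (cases "S x \<ge> 0")
    case True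
    hence "t * S x \<le> r * S x" by (intro mult_right_mono) (auto simp: r_def)
    thus ?thesis by (simp add: add_increasing)
  next
    case False
    hence "t * S x \<le> 0" using assms by (simp add: mult_nonneg_nonpos)
    thus ?thesis by (simp add: add_increasing2)
  qed
  hence "exp (t * S x) * norm (g x) \<le> (1 + exp (r * S x)) * norm (g x)" for x
    by (intro mult_right_mono) auto
  thus "AE x in M. norm (exp (t * S x) * norm (g x)) \<le> norm (norm (g x) + norm (of_real (exp (r * S x)) * g x))"
    by (intro AE_I2) (simp add: norm_mult ring_distribs)
  show "(\<lambda>x. exp (t * S x) * norm (g x)) \<in> borel_measurable M" by measurable
qed

text \<open>
  Differentiation under the integral sign. At \<open>z\<close> with \<open>Re z = 2\<delta>\<close> the difference quotients with
  steps of size below \<open>\<delta>\<close> are dominated by \<open>(e\<^sup>4\<^sup>\<delta>\<^sup>S + 1) |g| / \<delta>\<close>, using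
  \<open>|e\<^sup>w - 1| \<le> |w| e\<^sup>|\<^sup>w\<^sup>|\<close>.
\<close>

lemma laplace_holomorphic:
  "(\<lambda>z. LINT x|M. exp (z * of_real (S x)) * g x) holomorphic_on {z. Re z > 0}"
proof (rule holomorphic_onI)
  note [measurable] = borel_measurable_integrable[OF g_int]
  fix z assume "z \<in> {z. Re z > 0}"
  define \<delta> where "\<delta> = Re z / 2"
  have \<delta>: "\<delta> > 0" "Re z = 2 * \<delta>" using \<open>z \<in> _\<close> by (auto simp: \<delta>_def)
  define F where "F = (\<lambda>z. LINT x|M. exp (z * of_real (S x)) * g x)"
  have int: "integrable M (\<lambda>x. exp (w * of_real (S x)) * g x)" if "Re w \<ge> 0" for w
    by (rule Bochner_Integration.integrable_bound[OF laplace_weight_integrable[OF that]])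
      (auto simp: norm_mult)
  have "(F has_field_derivative (LINT x|M. of_real (S x) * (exp (z * of_real (S x)) * g x))) (at z)"
    unfolding has_field_derivative_iff tendsto_at_iff_sequentially
  proof (intro allI impI)
    fix X :: "nat \<Rightarrow> complex" assume X: "\<forall>i. X i \<in> UNIV - {z}" "X \<longlonglongrightarrow> z"
    have "eventually (\<lambda>i. dist (X i) z < \<delta>) sequentially" using X(2) \<delta> by (auto simp: tendsto_iff)
    then obtain N where N: "\<And>i. i \<ge> N \<Longrightarrow> norm (X i - z) < \<delta>"
      unfolding eventually_sequentially by (auto simp: dist_norm)
    define Y where "Y = (\<lambda>i. X (i + N))"
    have Y: "Y \<longlonglongrightarrow> z" "\<And>i. Y i \<noteq> z" "\<And>i. norm (Y i - z) < \<delta>"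
      using X N LIMSEQ_ignore_initial_segment[OF X(2)] by (auto simp: Y_def)
    have Re_Y: "Re (Y i) \<ge> 0" for i
      using abs_Re_le_cmod[of "Y i - z"] Y(3)[of i] \<delta> by simp
    let ?q = "\<lambda>w x. (exp (w * of_real (S x)) - exp (z * of_real (S x))) / (w - z) * g x"
    have lim: "(\<lambda>i. LINT x|M. ?q (Y i) x) \<longlonglongrightarrow> (LINT x|M. of_real (S x) * (exp (z * of_real (S x)) * g x))"
    proof (rule integral_dominated_convergence)
      show "integrable M (\<lambda>x. 1 / \<delta> * (exp (4 * \<delta> * S x) * norm (g x) + exp (0 * S x) * norm (g x)))"
        using \<delta> by (intro integrable_mult_right Bochner_Integration.integrable_add laplace_weight_integrable) auto
      show "AE x in M. (\<lambda>i. ?q (Y i) x) \<longlonglongrightarrow> of_real (S x) * (exp (z * of_real (S x)) * g x)"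
      proof (rule AE_I2)
        fix x
        have "((\<lambda>w. exp (w * of_real (S x))) has_field_derivative (of_real (S x) * exp (z * of_real (S x)))) (at z)"
          by (auto intro!: derivative_eq_intros)
        hence "(\<lambda>i. (exp (Y i * of_real (S x)) - exp (z * of_real (S x))) / (Y i - z)) \<longlonglongrightarrow> of_real (S x) * exp (z * of_real (S x))"
          unfolding has_field_derivative_iff tendsto_at_iff_sequentially using Y by (auto simp: comp_def)
        thus "(\<lambda>i. ?q (Y i) x) \<longlonglongrightarrow> of_real (S x) * (exp (z * of_real (S x)) * g x)"
          unfolding mult.assoc[symmetric] by (intro tendsto_mult tendsto_const)
      qed
      show "AE x in M. norm (?q (Y i) x) \<le> 1 / \<delta> * (exp (4 * \<delta> * S x) * norm (g x) + exp (0 * S x) * norm (g x))" for i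
      proof (rule AE_I2)
        fix x
        define h where "h = Y i - z"
        have h: "h \<noteq> 0" "norm h < \<delta>" using Y by (auto simp: h_def)
        have "exp (Y i * of_real (S x)) - exp (z * of_real (S x)) = exp (z * of_real (S x)) * (exp (h * of_real (S x)) - 1)"
          by (simp add: h_def right_diff_distrib exp_add[symmetric] algebra_simps)
        hence "norm (?q (Y i) x) = exp (2 * \<delta> * S x) * norm (exp (h * of_real (S x)) - 1) / norm h * norm (g x)"
          by (simp add: norm_mult norm_divide \<delta> h_def)
        also have "norm (exp (h * of_real (S x)) - 1) \<le> exp \<bar>Re (h * of_real (S x))\<bar> * norm (h * of_real (S x))"
          using Taylor_exp[of "h * of_real (S x)" 0] by simp
        also have "\<dots> \<le> exp (\<delta> * \<bar>S x\<bar>) * (norm h * (exp (\<delta> * \<bar>S x\<bar>) / \<delta>))"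
        proof (intro mult_mono)
          have "\<bar>Re h\<bar> \<le> \<delta>" using abs_Re_le_cmod[of h] h by linarith
          hence "\<bar>Re h\<bar> * \<bar>S x\<bar> \<le> \<delta> * \<bar>S x\<bar>" by (intro mult_right_mono) auto
          thus "exp \<bar>Re (h * of_real (S x))\<bar> \<le> exp (\<delta> * \<bar>S x\<bar>)" by (simp add: abs_mult)
          have "\<delta> * \<bar>S x\<bar> \<le> exp (\<delta> * \<bar>S x\<bar>)" using exp_ge_add_one_self[of "\<delta> * \<bar>S x\<bar>"] by linarith
          hence "\<bar>S x\<bar> \<le> exp (\<delta> * \<bar>S x\<bar>) / \<delta>" using \<delta> by (simp add: field_simps)
          thus "norm (h * of_real (S x)) \<le> norm h * (exp (\<delta> * \<bar>S x\<bar>) / \<delta>)"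
            by (simp add: norm_mult mult_left_mono del: times_divide_eq_right)
        qed auto
        also have "\<dots> = norm h * (exp (2 * \<delta> * \<bar>S x\<bar>) / \<delta>)"
          by (simp add: exp_add[symmetric])
        finally have "norm (?q (Y i) x) \<le> exp (2 * \<delta> * S x) * (norm h * (exp (2 * \<delta> * \<bar>S x\<bar>) / \<delta>)) / norm h * norm (g x)"
          by (simp add: mult_right_mono mult_left_mono divide_right_mono)
        also have "\<dots> = 1 / \<delta> * (exp (2 * \<delta> * S x + 2 * \<delta> * \<bar>S x\<bar>) * norm (g x))"
          using h by (simp add: exp_add)
        also have "exp (2 * \<delta> * S x + 2 * \<delta> * \<bar>S x\<bar>) \<le> exp (4 * \<delta> * S x) + exp (0 * S x)"
          by (cases "S x \<ge> 0") (auto simp: add_increasing add_increasing2)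
        finally show "norm (?q (Y i) x) \<le> 1 / \<delta> * (exp (4 * \<delta> * S x) * norm (g x) + exp (0 * S x) * norm (g x))"
          using \<delta> by (simp add: mult_right_mono divide_right_mono ring_distribs)
      qed
    qed (measurable)
    have eq: "(LINT x|M. ?q (Y i) x) = (F (Y i) - F z) / (Y i - z)" for i
    proof -
      have "(LINT x|M. ?q (Y i) x) = (LINT x|M. (exp (Y i * of_real (S x)) * g x - exp (z * of_real (S x)) * g x) / (Y i - z))"
        by (simp add: left_diff_distrib)
      also have "\<dots> = (F (Y i) - F z) / (Y i - z)"
        unfolding F_def using int[of "Y i"] int[of z] Re_Y[of i] \<delta>
        by (subst Bochner_Integration.integral_diff[symmetric]) auto
      finally show ?thesis .
    qed
    show "((\<lambda>w. (F w - F z) / (w - z)) \<circ> X) \<longlonglongrightarrow> (LINT x|M. of_real (S x) * (exp (z * of_real (S x)) * g x))"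
      using lim unfolding eq by (subst LIMSEQ_offset[where k = N]) (auto simp: Y_def comp_def intro: LIMSEQ_offset[where k = N])
  qed
  thus "(\<lambda>z. LINT x|M. exp (z * of_real (S x)) * g x) field_differentiable (at z within {z. Re z > 0})"
    unfolding F_def field_differentiable_def by (blast intro: DERIV_subset)
qed

lemma laplace_tendsto_0:
  "(\<lambda>n. LINT x|M. exp (of_real (inverse (real (Suc n))) * of_real (S x)) * g x) \<longlonglongrightarrow> (LINT x|M. g x)"
proof (rule integral_dominated_convergence)
  note [measurable] = borel_measurable_integrable[OF g_int]
  show "integrable M (\<lambda>x. exp (1 * S x) * norm (g x) + exp (0 * S x) * norm (g x))"
    by (intro Bochner_Integration.integrable_add laplace_weight_integrable) auto
  show "AE x in M. (\<lambda>n. exp (of_real (inverse (real (Suc n))) * of_real (S x)) * g x) \<longlonglongrightarrow> g x"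
  proof (rule AE_I2)
    fix x
    have "(\<lambda>n. exp (complex_of_real (inverse (real (Suc n))) * of_real (S x)) * g x) \<longlonglongrightarrow> exp (of_real 0 * of_real (S x)) * g x"
      by (intro tendsto_intros LIMSEQ_inverse_real_of_nat)
    thus "(\<lambda>n. exp (of_real (inverse (real (Suc n))) * of_real (S x)) * g x) \<longlonglongrightarrow> g x" by simp
  qed
  show "AE x in M. norm (exp (complex_of_real (inverse (real (Suc n))) * of_real (S x)) * g x)
      \<le> exp (1 * S x) * norm (g x) + exp (0 * S x) * norm (g x)" for n
  proof (rule AE_I2)
    fix x
    define t where "t = inverse (real (Suc n))"
    have t: "0 \<le> t" "t \<le> 1" by (auto simp: t_def field_simps)
    have "exp (t * S x) \<le> exp (1 * S x) + exp (0 * S x)"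
    proof (cases "S x \<ge> 0")
      case True
      hence "t * S x \<le> 1 * S x" using t by (intro mult_right_mono) auto
      thus ?thesis by (simp add: add_increasing2)
    next
      case False
      hence "t * S x \<le> 0" using t by (simp add: mult_nonneg_nonpos)
      thus ?thesis by (simp add: add_increasing)
    qed
    hence "exp (t * S x) * norm (g x) \<le> (exp (1 * S x) + exp (0 * S x)) * norm (g x)" by (intro mult_right_mono) auto
    thus "norm (exp (complex_of_real (inverse (real (Suc n))) * of_real (S x)) * g x)
      \<le> exp (1 * S x) * norm (g x) + exp (0 * S x) * norm (g x)"
      unfolding t_def by (simp add: norm_mult ring_distribs del: of_real_inverse of_nat_Suc of_real_of_nat_eq)
  qed
  show "(\<lambda>x. exp (of_real (inverse (real (Suc n))) * of_real (S x)) * g x) \<in> borel_measurable M" for n by measurable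
qed (use g_int in simp)

text \<open>
  The transform is multiplied by an entire function \<open>R\<close> rather than compared with a quotient: for
  reciprocal Gamma factors \<open>R\<close> the relation stays meaningful at the poles of the Gamma functions.
\<close>

lemma laplace_continuation:
  assumes R: "R holomorphic_on UNIV"
    and eq: "\<And>z. Re z > T \<Longrightarrow> (LINT x|M. exp (z * of_real (S x)) * g x) * R z = c"
  shows "(LINT x|M. g x) * R 0 = c"
proof -
  define F where "F = (\<lambda>z. LINT x|M. exp (z * of_real (S x)) * g x)"
  have FR: "F z * R z = c" if "Re z > 0" for z
  proof (rule analytic_continuation_open[where f = "\<lambda>z. F z * R z" and g = "\<lambda>_. c"])
    show "open {z. Re z > max T 0}" "open {z. Re z > 0}" by (rule open_halfspace_Re_gt)+
    show "{z. Re z > max T 0} \<noteq> {}" by (auto intro!: exI[of _ "of_real (max T 0 + 1)"])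
    show "connected {z. Re z > 0}" by (intro convex_connected convex_halfspace_Re_gt)
    show "(\<lambda>z. F z * R z) holomorphic_on {z. Re z > 0}"
      unfolding F_def by (intro holomorphic_on_mult laplace_holomorphic holomorphic_on_subset[OF R]) auto
  qed (use that eq in \<open>auto simp: F_def\<close>)
  let ?z = "\<lambda>n. complex_of_real (inverse (real (Suc n)))"
  have "isCont R 0"
    using holomorphic_on_imp_continuous_on[OF R] by (simp add: continuous_on_eq_continuous_at)
  moreover have "?z \<longlonglongrightarrow> 0"
    using tendsto_of_real[OF LIMSEQ_inverse_real_of_nat] by (simp only: of_real_0)
  ultimately have "(\<lambda>n. R (?z n)) \<longlonglongrightarrow> R 0" by (rule isCont_tendsto_compose)
  hence "(\<lambda>n. F (?z n) * R (?z n)) \<longlonglongrightarrow> (LINT x|M. g x) * R 0"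
    using laplace_tendsto_0 unfolding F_def by (intro tendsto_mult)
  moreover have "F (?z n) * R (?z n) = c" for n by (rule FR) simp
  ultimately show ?thesis by (simp add: LIMSEQ_const_iff)
qed

end

section \<open>The recursive structure of the Givental integral\<close>

interpretation lborel_PiM: product_sigma_finite "\<lambda>_ :: 'i. lborel :: real measure"
  by standard

lemma pair_sigma_finite_lborel_Pi:
  "finite I \<Longrightarrow> finite J \<Longrightarrow> pair_sigma_finite (lborel_Pi I) (lborel_Pi J)"
  by (intro pair_sigma_finite.intro lborel_PiM.sigma_finite)

lemma finite_givental_index [simp]: "finite (givental_index l)"
  by (simp add: givental_index_def)

text \<open>
  The factor of the Givental integrand that involves the outermost row \<open>x\<close>, of length \<open>n + 1\<close>; here \<open>u\<close>
  is the row of length \<open>n\<close> next to it.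
\<close>

definition givental_kernel :: "nat \<Rightarrow> complex \<Rightarrow> (nat \<Rightarrow> real) \<Rightarrow> (nat \<Rightarrow> real) \<Rightarrow> complex" where
  "givental_kernel n \<mu> x u =
    exp (\<i> * \<mu> * of_real ((\<Sum>i=1..n+1. x i) - (\<Sum>i=1..n. u i))
         - of_real (\<Sum>i=1..n. exp (x i - u i) + exp (u i - x (i+1))))"

lemma givental_kernel_cong:
  assumes "\<And>i. 1 \<le> i \<Longrightarrow> i \<le> n + 1 \<Longrightarrow> x i = x' i" "\<And>i. 1 \<le> i \<Longrightarrow> i \<le> n \<Longrightarrow> u i = u' i"
  shows "givental_kernel n \<mu> x u = givental_kernel n \<mu> x' u'"
proof -
  have "(\<Sum>i=1..n+1. x i) = (\<Sum>i=1..n+1. x' i)" "(\<Sum>i=1..n. u i) = (\<Sum>i=1..n. u' i)"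
       "(\<Sum>i=1..n. exp (x i - u i) + exp (u i - x (i+1))) = (\<Sum>i=1..n. exp (x' i - u' i) + exp (u' i - x' (i+1)))"
    using assms by (auto intro!: sum.cong)
  thus ?thesis by (simp only: givental_kernel_def)
qed

lemma givental_integrand_cong:
  assumes "\<And>k i. 1 \<le> i \<Longrightarrow> i \<le> k \<Longrightarrow> k \<le> l + 1 \<Longrightarrow> X k i = Y k i"
  shows "givental_integrand l \<Lambda> X = givental_integrand l \<Lambda> Y"
proof -
  have 1: "(\<Sum>k=1..l+1. \<Lambda> k * of_real ((\<Sum>i=1..k. X k i) - (\<Sum>i=1..k-1. X (k-1) i)))
      = (\<Sum>k=1..l+1. \<Lambda> k * of_real ((\<Sum>i=1..k. Y k i) - (\<Sum>i=1..k-1. Y (k-1) i)))"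
    using assms by (intro sum.cong arg_cong2[of _ _ _ _ "(*)"] arg_cong[of _ _ of_real] arg_cong2[of _ _ _ _ "(-)"] refl) auto
  have 2: "(\<Sum>k=1..l. \<Sum>i=1..k. exp (X (k+1) i - X k i) + exp (X k i - X (k+1) (i+1)))
      = (\<Sum>k=1..l. \<Sum>i=1..k. exp (Y (k+1) i - Y k i) + exp (Y k i - Y (k+1) (i+1)))"
    using assms by (intro sum.cong refl) auto
  show ?thesis by (simp only: givental_integrand_def 1 2)
qed

lemma givental_integrand_0: "givental_integrand 0 \<Lambda> X = givental_kernel 0 (\<Lambda> 1) (X 1) u"
  by (simp add: givental_integrand_def givental_kernel_def mult.assoc)

lemma givental_integrand_Suc:
  "givental_integrand (Suc l) \<Lambda> X = givental_kernel (Suc l) (\<Lambda> (l+2)) (X (l+2)) (X (l+1)) * givental_integrand l \<Lambda> X"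
  unfolding givental_integrand_def givental_kernel_def exp_add[symmetric]
  by (rule arg_cong[of _ _ exp]) (simp add: algebra_simps)

lemma borel_measurable_baxter_kernel:
  assumes [measurable]: "\<And>i. i \<in> {1..l+1} \<Longrightarrow> (\<lambda>w. Y w i) \<in> borel_measurable M"
    "\<And>i. i \<in> {1..l+1} \<Longrightarrow> (\<lambda>w. X w i) \<in> borel_measurable M"
  shows "(\<lambda>w. baxter_kernel l (Y w) (X w) \<gamma>) \<in> borel_measurable M"
  unfolding baxter_kernel_def by measurable

lemma borel_measurable_givental_kernel:
  assumes [measurable]: "\<And>i. i \<in> {1..l+1} \<Longrightarrow> (\<lambda>w. X w i) \<in> borel_measurable M"
    "\<And>i. i \<in> {1..l} \<Longrightarrow> (\<lambda>w. U w i) \<in> borel_measurable M"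
  shows "(\<lambda>w. givental_kernel l \<mu> (X w) (U w)) \<in> borel_measurable M"
  unfolding givental_kernel_def by measurable

lemma borel_measurable_givental_integrand:
  assumes [measurable]: "\<And>k i. (k, i) \<in> givental_index (Suc l) \<Longrightarrow> (\<lambda>w. X w k i) \<in> borel_measurable M"
  shows "(\<lambda>w. givental_integrand l \<Lambda> (X w)) \<in> borel_measurable M"
  unfolding givental_integrand_def by measurable (auto simp: givental_index_def)

lemma measurable_lborel_Pi_component:
  "i \<in> I \<Longrightarrow> (\<lambda>x. x i) \<in> borel_measurable (lborel_Pi I)"
  by measurable

lemma measurable_givental_array:
  assumes "(k, i) \<in> givental_index (Suc l)"
  shows "(\<lambda>(x, u). givental_array l x u k i) \<in> borel_measurable (lborel_Pi {1..l+1} \<Otimes>\<^sub>M lborel_Pi (givental_index l))"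
proof (cases "k = l + 1")
  case True
  hence [measurable]: "(\<lambda>x. x i) \<in> borel_measurable (lborel_Pi {1..l+1})"
    using assms by (intro measurable_lborel_Pi_component) (auto simp: givental_index_def)
  have "(\<lambda>(x, u). givental_array l x u k i) = (\<lambda>z. fst z i)"
    using True by (auto simp: givental_array_def fun_eq_iff)
  thus ?thesis by (simp only:) measurable
next
  case False
  hence [measurable]: "(\<lambda>u. u (k, i)) \<in> borel_measurable (lborel_Pi (givental_index l))"
    using assms by (intro measurable_lborel_Pi_component) (auto simp: givental_index_def)
  have "(\<lambda>(x, u). givental_array l x u k i) = (\<lambda>z. snd z (k, i))"
    using False by (auto simp: givental_array_def fun_eq_iff)
  thus ?thesis by (simp only:) measurable
qed

lemma measurable_givental_integrand_array:
  "(\<lambda>(x, u). givental_integrand l \<Lambda> (givental_array l x u))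
     \<in> borel_measurable (lborel_Pi {1..l+1} \<Otimes>\<^sub>M lborel_Pi (givental_index l))"
  unfolding case_prod_beta
  by (intro borel_measurable_givental_integrand) (use measurable_givental_array in \<open>auto simp: case_prod_beta\<close>)

lemma measurable_whittaker [measurable]:
  "whittaker l \<Lambda> \<in> borel_measurable (lborel_Pi {1..l+1})"
proof -
  interpret sigma_finite_measure "lborel_Pi (givental_index l)" by (intro lborel_PiM.sigma_finite) simp
  show ?thesis unfolding whittaker_def[abs_def]
    by (intro borel_measurable_lebesgue_integral measurable_givental_integrand_array)
qed

text \<open>
  Puts the row \<open>w\<close> under the triangular array \<open>u\<close>. This identifies the integration domain of rank
  \<open>l + 1\<close> with a product of a Euclidean space and the domain of rank \<open>l\<close>.
\<close>

definition givental_stack :: "nat \<Rightarrow> (nat \<Rightarrow> real) \<times> (nat \<times> nat \<Rightarrow> real) \<Rightarrow> nat \<times> nat \<Rightarrow> real" where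
  "givental_stack l = (\<lambda>(w, u). \<lambda>p\<in>givental_index (Suc l). givental_array l w u (fst p) (snd p))"

lemma measurable_givental_stack [measurable]:
  "givental_stack l \<in> lborel_Pi {1..l+1} \<Otimes>\<^sub>M lborel_Pi (givental_index l) \<rightarrow>\<^sub>M lborel_Pi (givental_index (Suc l))"
  unfolding givental_stack_def case_prod_beta
  by (intro measurable_restrict) (use measurable_givental_array in \<open>auto simp: case_prod_beta\<close>)

text \<open>
  The preimage of a box is a product of two boxes, and boxes determine the product measure.
\<close>

lemma distr_givental_stack:
  "distr (lborel_Pi {1..l+1} \<Otimes>\<^sub>M lborel_Pi (givental_index l)) (lborel_Pi (givental_index (Suc l))) (givental_stack l)
     = lborel_Pi (givental_index (Suc l))"
proof (rule lborel_PiM.PiM_eqI)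
  let ?R = "lborel_Pi {1..l+1}" and ?U = "lborel_Pi (givental_index l)"
  interpret pair_sigma_finite ?R ?U by (intro pair_sigma_finite_lborel_Pi) auto
  have idx: "givental_index (Suc l) = givental_index l \<union> Pair (Suc l) ` {1..Suc l}"
    and disj: "givental_index l \<inter> Pair (Suc l) ` {1..Suc l} = {}"
    by (auto simp: givental_index_def le_Suc_eq)
  fix A :: "nat \<times> nat \<Rightarrow> real set" assume A: "\<And>p. p \<in> givental_index (Suc l) \<Longrightarrow> A p \<in> sets lborel"
  let ?AR = "Pi\<^sub>E {1..l+1} (\<lambda>i. A (Suc l, i))" and ?AU = "Pi\<^sub>E (givental_index l) A"
  have vimage: "givental_stack l -` Pi\<^sub>E (givental_index (Suc l)) A \<inter> space (?R \<Otimes>\<^sub>M ?U) = ?AR \<times> ?AU"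
  proof (intro set_eqI iffI)
    fix z assume "z \<in> givental_stack l -` Pi\<^sub>E (givental_index (Suc l)) A \<inter> space (?R \<Otimes>\<^sub>M ?U)"
    then obtain w u where z: "z = (w, u)" "w \<in> extensional {1..l+1}" "u \<in> extensional (givental_index l)"
      and *: "\<And>p. p \<in> givental_index (Suc l) \<Longrightarrow> givental_array l w u (fst p) (snd p) \<in> A p"
      by (cases z) (auto simp: space_pair_measure space_PiM PiE_def givental_stack_def Pi_iff)
    have "w i \<in> A (Suc l, i)" if "i \<in> {1..l+1}" for i
      using *[of "(Suc l, i)"] that by (auto simp: idx givental_array_def)
    moreover have "u p \<in> A p" if "p \<in> givental_index l" for p
    proof -
      have "fst p \<noteq> l + 1" using that by (auto simp: givental_index_def)
      thus ?thesis using *[of p] that by (simp add: idx givental_array_def)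
    qed
    ultimately show "z \<in> ?AR \<times> ?AU" using z by (auto simp: PiE_def)
  next
    fix z assume z: "z \<in> ?AR \<times> ?AU"
    have "givental_array l (fst z) (snd z) (fst p) (snd p) \<in> A p" if "p \<in> givental_index (Suc l)" for p
      using that z by (cases "fst p = l + 1") (auto simp: idx givental_array_def givental_index_def PiE_def Pi_iff)
    thus "z \<in> givental_stack l -` Pi\<^sub>E (givental_index (Suc l)) A \<inter> space (?R \<Otimes>\<^sub>M ?U)"
      using z by (auto simp: space_pair_measure space_PiM PiE_def givental_stack_def)
  qed
  have "emeasure (distr (?R \<Otimes>\<^sub>M ?U) (lborel_Pi (givental_index (Suc l))) (givental_stack l)) (Pi\<^sub>E (givental_index (Suc l)) A)
     = emeasure (?R \<Otimes>\<^sub>M ?U) (?AR \<times> ?AU)"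
    unfolding vimage[symmetric]
    by (intro emeasure_distr measurable_givental_stack sets_PiM_I_finite) (use A in auto)
  also have "\<dots> = emeasure ?R ?AR * emeasure ?U ?AU"
    by (intro M2.emeasure_pair_measure_Times sets_PiM_I_finite) (use A idx in auto)
  also have "\<dots> = (\<Prod>i\<in>{1..l+1}. emeasure lborel (A (Suc l, i))) * (\<Prod>p\<in>givental_index l. emeasure lborel (A p))"
    by (intro arg_cong2[of _ _ _ _ "(*)"] lborel_PiM.emeasure_PiM) (use A idx in auto)
  also have "\<dots> = (\<Prod>p\<in>givental_index (Suc l). emeasure lborel (A p))"
    unfolding idx by (subst prod.union_disjoint[OF _ _ disj]) (auto simp: prod.reindex inj_on_def mult.commute)
  finally show "emeasure (distr (?R \<Otimes>\<^sub>M ?U) (lborel_Pi (givental_index (Suc l))) (givental_stack l)) (Pi\<^sub>E (givental_index (Suc l)) A)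
     = (\<Prod>p\<in>givental_index (Suc l). emeasure lborel (A p))" .
qed auto

lemma givental_integrand_stack:
  "givental_integrand (Suc l) \<Lambda> (givental_array (Suc l) x (givental_stack l (w, u)))
    = givental_kernel (Suc l) (\<Lambda> (l+2)) x w * givental_integrand l \<Lambda> (givental_array l w u)"
proof -
  let ?X = "givental_array (Suc l) x (givental_stack l (w, u))"
  have X: "?X k i = givental_array l w u k i" if "1 \<le> i" "i \<le> k" "k \<le> l + 1" for k i
    using that by (auto simp: givental_array_def givental_stack_def givental_index_def)
  have "givental_kernel (Suc l) (\<Lambda> (l+2)) (?X (l+2)) (?X (l+1)) = givental_kernel (Suc l) (\<Lambda> (l+2)) x w"
    by (intro givental_kernel_cong) (auto simp: X, auto simp: givental_array_def)
  moreover have "givental_integrand l \<Lambda> ?X = givental_integrand l \<Lambda> (givental_array l w u)"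
    by (intro givental_integrand_cong X) auto
  ultimately show ?thesis by (simp only: givental_integrand_Suc)
qed

text \<open>
  The Givental integral of absolute values, with values in the extended half line so that Tonelli's
  theorem applies to it before its finiteness is known.
\<close>

definition abs_whittaker :: "nat \<Rightarrow> (nat \<Rightarrow> complex) \<Rightarrow> (nat \<Rightarrow> real) \<Rightarrow> ennreal" where
  "abs_whittaker l \<Lambda> x =
    (\<integral>\<^sup>+u. ennreal (norm (givental_integrand l \<Lambda> (givental_array l x u))) \<partial>lborel_Pi (givental_index l))"

lemma measurable_abs_whittaker [measurable]:
  "abs_whittaker l \<Lambda> \<in> borel_measurable (lborel_Pi {1..l+1})"
proof -
  interpret sigma_finite_measure "lborel_Pi (givental_index l)" by (intro lborel_PiM.sigma_finite) simp
  have "(\<lambda>z::complex. ennreal (norm z)) \<in> borel_measurable borel" by measurable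
  from measurable_compose[OF measurable_givental_integrand_array this]
  show ?thesis unfolding abs_whittaker_def[abs_def]
    by (intro borel_measurable_nn_integral) (simp only: case_prod_beta case_prod_beta')
qed

lemma measurable_givental_integrand_argument:
  "(\<lambda>u. givental_integrand l \<Lambda> (givental_array l x u)) \<in> borel_measurable (lborel_Pi (givental_index l))"
proof (intro borel_measurable_givental_integrand)
  fix k i assume "(k, i) \<in> givental_index (Suc l)"
  thus "(\<lambda>u. givental_array l x u k i) \<in> borel_measurable (lborel_Pi (givental_index l))"
    by (cases "k = l + 1") (auto simp: givental_array_def givental_index_def le_Suc_eq intro!: measurable_lborel_Pi_component)
qed

lemma givental_index_0: "givental_index 0 = {}"
  by (simp add: givental_index_def)

lemma abs_whittaker_0: "abs_whittaker 0 \<Lambda> x = ennreal (norm (givental_kernel 0 (\<Lambda> 1) x u))"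
proof -
  have "givental_integrand 0 \<Lambda> (givental_array 0 x v) = givental_kernel 0 (\<Lambda> 1) x u" for v
    by (subst givental_integrand_0[of _ _ u]) (rule givental_kernel_cong, auto simp: givental_array_def)
  thus ?thesis unfolding abs_whittaker_def givental_index_0 by (simp only: lborel_PiM.nn_integral_empty zero_le)
qed

text \<open>
  The row \<open>u\<close> is arbitrary because it has length \<open>0\<close>.
\<close>

lemma whittaker_0: "whittaker 0 \<Lambda> x = givental_kernel 0 (\<Lambda> 1) x u"
proof -
  have "givental_integrand 0 \<Lambda> (givental_array 0 x v) = givental_kernel 0 (\<Lambda> 1) x u" for v
    by (subst givental_integrand_0[of _ _ u]) (rule givental_kernel_cong, auto simp: givental_array_def)
  thus ?thesis unfolding whittaker_def givental_index_0 by (simp add: PiM_empty lebesgue_integral_count_space_finite)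
qed

lemma abs_whittaker_Suc:
  "abs_whittaker (Suc l) \<Lambda> x =
    (\<integral>\<^sup>+w. ennreal (norm (givental_kernel (Suc l) (\<Lambda> (l+2)) x w)) * abs_whittaker l \<Lambda> w \<partial>lborel_Pi {1..l+1})"
proof -
  let ?R = "lborel_Pi {1..l+1}" and ?U = "lborel_Pi (givental_index l)"
  interpret pair_sigma_finite ?R ?U by (intro pair_sigma_finite_lborel_Pi) auto
  let ?f = "\<lambda>u. ennreal (norm (givental_integrand (Suc l) \<Lambda> (givental_array (Suc l) x u)))"
  have f [measurable]: "?f \<in> borel_measurable (lborel_Pi (givental_index (Suc l)))"
    using measurable_givental_integrand_argument[of "Suc l" \<Lambda> x] by measurable
  have "abs_whittaker (Suc l) \<Lambda> x = (\<integral>\<^sup>+u. ?f u \<partial>distr (?R \<Otimes>\<^sub>M ?U) (lborel_Pi (givental_index (Suc l))) (givental_stack l))"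
    unfolding distr_givental_stack abs_whittaker_def ..
  also have "\<dots> = (\<integral>\<^sup>+z. ?f (givental_stack l z) \<partial>(?R \<Otimes>\<^sub>M ?U))"
    by (intro nn_integral_distr) measurable
  also have "\<dots> = (\<integral>\<^sup>+w. \<integral>\<^sup>+u. ?f (givental_stack l (w, u)) \<partial>?U \<partial>?R)"
    by (subst M2.nn_integral_fst[symmetric]) measurable
  also have "\<dots> = (\<integral>\<^sup>+w. ennreal (norm (givental_kernel (Suc l) (\<Lambda> (l+2)) x w)) * abs_whittaker l \<Lambda> w \<partial>?R)"
  proof (rule nn_integral_cong)
    fix w
    note [measurable] = measurable_givental_integrand_argument[of l \<Lambda> w]
    show "(\<integral>\<^sup>+u. ?f (givental_stack l (w, u)) \<partial>?U)
        = ennreal (norm (givental_kernel (Suc l) (\<Lambda> (l+2)) x w)) * abs_whittaker l \<Lambda> w"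
      unfolding abs_whittaker_def givental_integrand_stack norm_mult ennreal_mult'[OF norm_ge_zero]
      by (rule nn_integral_cmult) measurable
  qed
  finally show ?thesis .
qed

lemma whittaker_Suc:
  assumes "abs_whittaker (Suc l) \<Lambda> x < \<infinity>"
  shows "whittaker (Suc l) \<Lambda> x =
    (LINT w|lborel_Pi {1..l+1}. givental_kernel (Suc l) (\<Lambda> (l+2)) x w * whittaker l \<Lambda> w)"
proof -
  let ?R = "lborel_Pi {1..l+1}" and ?U = "lborel_Pi (givental_index l)"
  interpret pair_sigma_finite ?R ?U by (intro pair_sigma_finite_lborel_Pi) auto
  let ?f = "\<lambda>u. givental_integrand (Suc l) \<Lambda> (givental_array (Suc l) x u)"
  have f [measurable]: "?f \<in> borel_measurable (lborel_Pi (givental_index (Suc l)))"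
    by (rule measurable_givental_integrand_argument)
  have "integrable (lborel_Pi (givental_index (Suc l))) ?f"
    using assms unfolding abs_whittaker_def by (intro integrableI_bounded f)
  hence I: "integrable (?R \<Otimes>\<^sub>M ?U) (\<lambda>z. ?f (givental_stack l z))"
    by (subst (asm) distr_givental_stack[symmetric], subst (asm) integrable_distr_eq) measurable
  have "whittaker (Suc l) \<Lambda> x = (LINT u|distr (?R \<Otimes>\<^sub>M ?U) (lborel_Pi (givental_index (Suc l))) (givental_stack l). ?f u)"
    unfolding distr_givental_stack whittaker_def ..
  also have "\<dots> = (LINT z|(?R \<Otimes>\<^sub>M ?U). ?f (givental_stack l z))"
    by (intro integral_distr) measurable
  also have "\<dots> = (LINT w|?R. LINT u|?U. ?f (givental_stack l (w, u)))"
    by (rule integral_fst'[OF I, symmetric])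
  also have "\<dots> = (LINT w|?R. givental_kernel (Suc l) (\<Lambda> (l+2)) x w * whittaker l \<Lambda> w)"
    unfolding givental_integrand_stack whittaker_def by simp
  finally show ?thesis .
qed

lemma norm_whittaker_le: "ennreal (norm (whittaker l \<Lambda> x)) \<le> abs_whittaker l \<Lambda> x"
  unfolding whittaker_def abs_whittaker_def
  by (cases "integrable (lborel_Pi (givental_index l)) (\<lambda>u. givental_integrand l \<Lambda> (givental_array l x u))")
    (simp_all add: integral_norm_bound_ennreal not_integrable_integral_eq)

lemma norm_givental_kernel:
  "norm (givental_kernel n \<mu> x u) =
    exp (Re (\<i> * \<mu>) * ((\<Sum>i=1..n+1. x i) - (\<Sum>i=1..n. u i)) - (\<Sum>i=1..n. exp (x i - u i) + exp (u i - x (i+1))))"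
  by (simp only: givental_kernel_def norm_exp_eq_Re minus_complex.sel Re_complex_of_real times_complex.sel Im_complex_of_real mult_zero_right diff_zero)

text \<open>
  Exponential growth is reproduced by the recursion: each new integration variable is confined by its two
  neighbours in the next row, and integrating an exponential of it gives an exponential of these
  neighbours. Finiteness alone would not survive the induction, since the next step integrates over
  the argument.
\<close>

lemma abs_whittaker_growth:
  "\<exists>C c. C \<ge> 0 \<and> c \<ge> 0 \<and> (\<forall>x. abs_whittaker l \<Lambda> x \<le> ennreal (C * exp (c * (\<Sum>i=1..l+1. \<bar>x i\<bar>))))"
proof (induction l)
  case 0
  define c where "c = \<bar>Re (\<i> * \<Lambda> 1)\<bar>"
  have "abs_whittaker 0 \<Lambda> x \<le> ennreal (1 * exp (c * (\<Sum>i=1..0+1. \<bar>x i\<bar>)))" for x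
  proof -
    have "Re (\<i> * \<Lambda> 1) * x 1 \<le> c * \<bar>x 1\<bar>"
      unfolding c_def by (metis abs_ge_self abs_mult)
    thus ?thesis by (subst abs_whittaker_0[of _ _ "\<lambda>_. 0"]) (simp add: norm_givental_kernel)
  qed
  moreover have "c \<ge> 0" by (simp add: c_def)
  ultimately show ?case by (intro exI[of _ 1] exI[of _ c]) auto
next
  case (Suc l)
  then obtain C c where C: "C \<ge> 0" "c \<ge> 0" and
    IH: "\<And>x. abs_whittaker l \<Lambda> x \<le> ennreal (C * exp (c * (\<Sum>i=1..l+1. \<bar>x i\<bar>)))" by blast
  define a where "a = \<bar>Re (\<i> * \<Lambda> (l+2))\<bar>"
  \<comment> \<open>the summand 1 keeps the exponent positive, for which the one-dimensional integrals are bounded above\<close>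
  define b where "b = a + c + 1"
  have ab: "a \<ge> 0" "b > 0" using C by (auto simp: a_def b_def)
  define e where "e = a + real (l + 1) * (b * 2)"
  define D where "D = C * (2 * Gamma b) ^ (l + 1)"
  have D: "D \<ge> 0" using C ab by (simp add: D_def Gamma_real_pos less_imp_le)
  have "abs_whittaker (Suc l) \<Lambda> x \<le> ennreal (D * exp (e * (\<Sum>i=1..Suc l+1. \<bar>x i\<bar>)))" for x
  proof -
    define \<Sigma> where "\<Sigma> = (\<Sum>i=1..Suc l+1. \<bar>x i\<bar>)"
    let ?h = "\<lambda>i u. ennreal (exp (b * \<bar>u\<bar> - (exp (x i - u) + exp (u - x (i+1)))))"
    have "abs_whittaker (Suc l) \<Lambda> x \<le> (\<integral>\<^sup>+w. ennreal (C * exp (a * \<Sigma>)) * (\<Prod>i\<in>{1..l+1}. ?h i (w i)) \<partial>lborel_Pi {1..l+1})"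
      unfolding abs_whittaker_Suc
    proof (rule nn_integral_mono)
      fix w :: "nat \<Rightarrow> real"
      define W where "W = (\<Sum>i=1..l+1. \<bar>w i\<bar>)"
      define P where "P = (\<Sum>i=1..l+1. exp (x i - w i) + exp (w i - x (i+1)))"
      have "W \<ge> 0" unfolding W_def by (intro sum_nonneg) auto
      have "\<bar>(\<Sum>i=1..Suc l+1. x i) - (\<Sum>i=1..l+1. w i)\<bar> \<le> \<bar>\<Sum>i=1..Suc l+1. x i\<bar> + \<bar>\<Sum>i=1..l+1. w i\<bar>" by linarith
      also have "\<dots> \<le> \<Sigma> + W" unfolding \<Sigma>_def W_def by (intro add_mono sum_abs)
      finally have "a * \<bar>(\<Sum>i=1..Suc l+1. x i) - (\<Sum>i=1..l+1. w i)\<bar> \<le> a * (\<Sigma> + W)"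
        using ab by (intro mult_left_mono)
      hence "Re (\<i> * \<Lambda> (l+2)) * ((\<Sum>i=1..Suc l+1. x i) - (\<Sum>i=1..l+1. w i)) \<le> a * (\<Sigma> + W)"
        unfolding a_def abs_mult[symmetric] by linarith
      hence "norm (givental_kernel (Suc l) (\<Lambda> (l+2)) x w) \<le> exp (a * (\<Sigma> + W) - P)"
        unfolding norm_givental_kernel P_def by simp
      hence "ennreal (norm (givental_kernel (Suc l) (\<Lambda> (l+2)) x w)) * abs_whittaker l \<Lambda> w
           \<le> ennreal (exp (a * (\<Sigma> + W) - P)) * ennreal (C * exp (c * W))"
        unfolding W_def by (intro mult_mono IH ennreal_leI) auto
      also have "\<dots> = ennreal (exp (a * (\<Sigma> + W) - P) * (C * exp (c * W)))"
        using C by (simp add: ennreal_mult)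
      also have "\<dots> \<le> ennreal (C * exp (a * \<Sigma>) * exp (b * W - P))"
      proof (rule ennreal_leI)
        have "exp (a * (\<Sigma> + W) - P) * (C * exp (c * W)) = C * exp (a * \<Sigma>) * exp ((a + c) * W - P)"
          by (simp add: exp_add exp_diff algebra_simps)
        also have "\<dots> \<le> C * exp (a * \<Sigma>) * exp (b * W - P)"
          using C \<open>W \<ge> 0\<close> by (intro mult_left_mono) (auto simp: b_def algebra_simps)
        finally show "exp (a * (\<Sigma> + W) - P) * (C * exp (c * W)) \<le> C * exp (a * \<Sigma>) * exp (b * W - P)" .
      qed
      also have "exp (b * W - P) = (\<Prod>i\<in>{1..l+1}. exp (b * \<bar>w i\<bar> - (exp (x i - w i) + exp (w i - x (i+1)))))"
        unfolding W_def P_def by (simp only: exp_sum[symmetric] finite_atLeastAtMost sum_subtractf sum_distrib_left)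
      finally show "ennreal (norm (givental_kernel (Suc l) (\<Lambda> (l+2)) x w)) * abs_whittaker l \<Lambda> w
           \<le> ennreal (C * exp (a * \<Sigma>)) * (\<Prod>i\<in>{1..l+1}. ?h i (w i))"
        using C by (simp add: ennreal_mult prod_ennreal prod_nonneg del: prod.cl_ivl_Suc)
    qed
    also have "\<dots> = ennreal (C * exp (a * \<Sigma>)) * (\<integral>\<^sup>+w. (\<Prod>i\<in>{1..l+1}. ?h i (w i)) \<partial>lborel_Pi {1..l+1})"
      by (rule nn_integral_cmult) measurable
    also have "(\<integral>\<^sup>+w. (\<Prod>i\<in>{1..l+1}. ?h i (w i)) \<partial>lborel_Pi {1..l+1}) = (\<Prod>i\<in>{1..l+1}. \<integral>\<^sup>+u. ?h i u \<partial>lborel)"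
      by (rule lborel_PiM.product_nn_integral_prod) auto
    also have "\<dots> \<le> (\<Prod>i\<in>{1..l+1}. ennreal (2 * Gamma b * exp (b * (2 * \<Sigma>))))"
    proof (rule prod_mono_ennreal)
      fix i assume i: "i \<in> {1..l+1}"
      have "\<bar>x i\<bar> \<le> \<Sigma>" "\<bar>x (i+1)\<bar> \<le> \<Sigma>" unfolding \<Sigma>_def using i by (auto intro!: member_le_sum simp del: sum.cl_ivl_Suc)
      hence "b * (\<bar>x i\<bar> + \<bar>x (i+1)\<bar>) \<le> b * (2 * \<Sigma>)" using ab by (intro mult_left_mono) auto
      hence "2 * Gamma b * exp (b * (\<bar>x i\<bar> + \<bar>x (i+1)\<bar>)) \<le> 2 * Gamma b * exp (b * (2 * \<Sigma>))"
        using ab by (intro mult_left_mono) (auto simp: Gamma_real_pos less_imp_le)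
      thus "(\<integral>\<^sup>+u. ?h i u \<partial>lborel) \<le> ennreal (2 * Gamma b * exp (b * (2 * \<Sigma>)))"
        using order.trans[OF nn_integral_exp_abs_le[OF ab(2)] ennreal_leI] by blast
    qed
    also have "\<dots> = ennreal ((2 * Gamma b * exp (b * (2 * \<Sigma>))) ^ (l + 1))"
      using ab by (simp add: ennreal_power Gamma_real_pos less_imp_le del: power_Suc)
    also have "(2 * Gamma b * exp (b * (2 * \<Sigma>))) ^ (l + 1) = (2 * Gamma b) ^ (l + 1) * exp (real (l + 1) * (b * (2 * \<Sigma>)))"
      by (simp only: power_mult_distrib exp_of_nat_mult)
    also have "ennreal (C * exp (a * \<Sigma>)) * ennreal ((2 * Gamma b) ^ (l + 1) * exp (real (l + 1) * (b * (2 * \<Sigma>))))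
       = ennreal (C * exp (a * \<Sigma>) * ((2 * Gamma b) ^ (l + 1) * exp (real (l + 1) * (b * (2 * \<Sigma>)))))"
      using C by (intro ennreal_mult[symmetric]) (auto simp: Gamma_real_pos less_imp_le ab)
    also have "C * exp (a * \<Sigma>) * ((2 * Gamma b) ^ (l + 1) * exp (real (l + 1) * (b * (2 * \<Sigma>)))) = D * exp (e * \<Sigma>)"
      unfolding D_def e_def by (simp add: exp_add[symmetric] algebra_simps)
    finally show ?thesis unfolding \<Sigma>_def by (simp add: mult_left_mono)
  qed
  moreover have "e \<ge> 0" using ab by (simp add: e_def)
  ultimately show ?case using D by blast
qed

section \<open>The intertwining relation of the kernels\<close>

text \<open>
  The coefficient of \<open>e^(- x\<^sub>i)\<close> in the exponent of the product of the two kernels, up to sign; the row \<open>u\<close> has no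
  entry to the left of its first one.
\<close>

definition left_weight :: "(nat \<Rightarrow> real) \<Rightarrow> (nat \<Rightarrow> real) \<Rightarrow> nat \<Rightarrow> real" where
  "left_weight y u i = exp (y i) + (if i = 1 then 0 else exp (u (i - 1)))"

text \<open>
  The coefficient of \<open>e^(x\<^sub>i)\<close> in the same exponent, for \<open>i \<le> n\<close>.
\<close>

definition right_weight :: "(nat \<Rightarrow> real) \<Rightarrow> (nat \<Rightarrow> real) \<Rightarrow> nat \<Rightarrow> real" where
  "right_weight y u i = exp (- y (i + 1)) + exp (- u i)"

lemma left_weight_pos: "left_weight y u i > 0"
  by (simp add: left_weight_def add_pos_pos)

lemma right_weight_pos: "right_weight y u i > 0"
  by (simp add: right_weight_def add_pos_pos)

lemma sum_left_weight:
  "(\<Sum>i=1..n+1. left_weight y u i * exp (- x i))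
     = (\<Sum>i=1..n. exp (y i - x i)) + exp (y (n+1) - x (n+1)) + (\<Sum>i=1..n. exp (u i - x (i+1)))"
  by (induction n) (auto simp: left_weight_def exp_add exp_diff exp_minus field_simps)

lemma sum_right_weight:
  "(\<Sum>i=1..n. right_weight y u i * exp (x i))
     = (\<Sum>i=1..n. exp (x i - y (i+1))) + (\<Sum>i=1..n. exp (x i - u i))"
  unfolding sum.distrib[symmetric]
  by (intro sum.cong) (auto simp: right_weight_def exp_add exp_diff exp_minus field_simps)

text \<open>
  The right weight at \<open>i\<close> is the left weight at \<open>i + 1\<close> divided by \<open>e^(y\<^sub>i\<^sub>+\<^sub>1 + u\<^sub>i)\<close>, so all logarithms
  of weights cancel except that of the first left weight, which is \<open>y\<^sub>1\<close>, and the sum of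
  the exponents \<open>y\<^sub>i\<^sub>+\<^sub>1 + u\<^sub>i\<close> remains.
\<close>

lemma sum_log_weights:
  "(\<Sum>i=1..n. ln (left_weight y u i) - ln (right_weight y u i)) + ln (left_weight y u (n+1))
     = (\<Sum>i=1..n+1. y i) + (\<Sum>i=1..n. u i)"
proof (induction n)
  case 0
  show ?case by (simp add: left_weight_def)
next
  case (Suc n)
  have "right_weight y u (n+1) = left_weight y u (n+2) * exp (- y (n+2) - u (n+1))"
    by (simp add: left_weight_def right_weight_def exp_diff exp_minus field_simps)
  hence "ln (right_weight y u (n+1)) = ln (left_weight y u (n+2)) - y (n+2) - u (n+1)"
    using left_weight_pos[of y u "n+2"] by (simp add: ln_mult)
  thus ?case using Suc.IH by simp
qed

lemma baxter_givental_factorization: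
  "baxter_kernel n y x \<gamma> * givental_kernel n \<mu> x u
    = exp (\<i> * \<gamma> * of_real (\<Sum>i=1..n+1. y i) - \<i> * \<mu> * of_real (\<Sum>i=1..n. u i)) *
      (\<Prod>i\<in>{1..n+1}. bessel_integrand (\<i> * \<gamma> - \<i> * \<mu>) (left_weight y u i)
          (if i = n + 1 then 0 else right_weight y u i) (x i))"
proof -
  let ?s = "\<i> * \<gamma> - \<i> * \<mu>"
  let ?B = "\<lambda>i. if i = n + 1 then 0 else right_weight y u i"
  have B: "(\<Sum>i=1..n+1. ?B i * exp (x i)) = (\<Sum>i=1..n. right_weight y u i * exp (x i))"
    by simp
  have "(\<Prod>i\<in>{1..n+1}. bessel_integrand ?s (left_weight y u i) (?B i) (x i))
      = exp (\<Sum>i=1..n+1. - ?s * of_real (x i) - of_real (left_weight y u i * exp (- x i) + ?B i * exp (x i)))"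
    unfolding bessel_integrand_def by (rule exp_sum[symmetric]) simp
  also have "(\<Sum>i=1..n+1. - ?s * of_real (x i) - of_real (left_weight y u i * exp (- x i) + ?B i * exp (x i)))
      = - ?s * of_real (\<Sum>i=1..n+1. x i) - of_real ((\<Sum>i=1..n+1. left_weight y u i * exp (- x i)) + (\<Sum>i=1..n+1. ?B i * exp (x i)))"
    by (simp only: sum_subtractf sum.distrib of_real_sum of_real_add sum_distrib_left)
  finally show ?thesis
    unfolding B sum_left_weight sum_right_weight baxter_kernel_def givental_kernel_def exp_add[symmetric]
    by (elim ssubst, simp only: exp_add[symmetric], intro arg_cong[of _ _ exp])
      (simp only: sum.distrib sum_subtractf of_real_add of_real_diff ring_distribs, simp add: algebra_simps)
qed

lemma givental_baxter_factorization:
  "givental_kernel (Suc m) \<mu> y v * baxter_kernel m v u \<gamma>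
    = exp (\<i> * \<mu> * of_real (\<Sum>i=1..Suc m+1. y i) - \<i> * \<gamma> * of_real (\<Sum>i=1..Suc m. u i)) *
      (\<Prod>i\<in>{1..Suc m}. bessel_integrand (- (\<i> * \<gamma> - \<i> * \<mu>)) (left_weight y u i) (right_weight y u i) (v i))"
proof -
  let ?s = "\<i> * \<gamma> - \<i> * \<mu>"
  have "(\<Prod>i\<in>{1..Suc m}. bessel_integrand (- ?s) (left_weight y u i) (right_weight y u i) (v i))
      = exp (\<Sum>i=1..Suc m. - (- ?s) * of_real (v i) - of_real (left_weight y u i * exp (- v i) + right_weight y u i * exp (v i)))"
    unfolding bessel_integrand_def by (rule exp_sum[symmetric]) simp
  also have "(\<Sum>i=1..Suc m. - (- ?s) * of_real (v i) - of_real (left_weight y u i * exp (- v i) + right_weight y u i * exp (v i)))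
      = - (- ?s) * of_real (\<Sum>i=1..Suc m. v i) - of_real ((\<Sum>i=1..m+1. left_weight y u i * exp (- v i)) + (\<Sum>i=1..Suc m. right_weight y u i * exp (v i)))"
    by (simp only: sum_subtractf sum.distrib of_real_sum of_real_add sum_distrib_left Suc_eq_plus1)
  finally show ?thesis
    unfolding sum_left_weight sum_right_weight baxter_kernel_def givental_kernel_def
    by (elim ssubst, simp only: exp_add[symmetric], intro arg_cong[of _ _ exp])
      (simp only: sum.distrib sum_subtractf of_real_add of_real_diff ring_distribs, simp add: algebra_simps)
qed

text \<open>
  The right-hand side is the value of the other composition of kernels, with the reflection already
  carried out; in this form it covers the case \<open>n = 0\<close> too, where no Baxter kernel of rank \<open>n - 1\<close> exists.
\<close>

lemma baxter_givental_integral: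
  fixes \<gamma> \<mu> :: complex
  defines "s \<equiv> \<i> * \<gamma> - \<i> * \<mu>"
  assumes s: "Re s > 0"
  shows "integrable (lborel_Pi {1..n+1}) (\<lambda>x. baxter_kernel n y x \<gamma> * givental_kernel n \<mu> x u)"
    and "(LINT x|lborel_Pi {1..n+1}. baxter_kernel n y x \<gamma> * givental_kernel n \<mu> x u)
      = Gamma s * (exp (\<i> * \<mu> * of_real (\<Sum>i=1..n+1. y i) - \<i> * \<gamma> * of_real (\<Sum>i=1..n. u i)) *
        (\<Prod>i\<in>{1..n}. LINT v|lborel. bessel_integrand (- s) (left_weight y u i) (right_weight y u i) v))"
proof -
  let ?A = "left_weight y u"
  define B where "B i = (if i = n + 1 then 0 else right_weight y u i)" for i
  have I: "integrable lborel (bessel_integrand s (?A i) (B i))" for i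
    using integral_bessel_gamma(1)[OF s left_weight_pos] integrable_bessel[OF left_weight_pos right_weight_pos]
    by (auto simp: B_def)
  note fact = baxter_givental_factorization[of n y _ \<gamma> \<mu> u, folded s_def B_def]
  show "integrable (lborel_Pi {1..n+1}) (\<lambda>x. baxter_kernel n y x \<gamma> * givental_kernel n \<mu> x u)"
    unfolding fact by (intro integrable_mult_right lborel_PiM.product_integrable_prod I) simp
  define J where "J = (\<lambda>i. LINT x|lborel. bessel_integrand s (?A i) (right_weight y u i) x)"
  define E where "E = (\<lambda>i. exp (s * of_real (ln (?A i) - ln (right_weight y u i))))"
  let ?a = "\<i> * \<gamma> * of_real (\<Sum>i=1..n+1. y i) - \<i> * \<mu> * of_real (\<Sum>i=1..n. u i)"
  let ?b = "\<i> * \<mu> * of_real (\<Sum>i=1..n+1. y i) - \<i> * \<gamma> * of_real (\<Sum>i=1..n. u i)"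
  have "(LINT x|lborel_Pi {1..n+1}. baxter_kernel n y x \<gamma> * givental_kernel n \<mu> x u)
     = exp ?a * (\<Prod>i\<in>{1..n+1}. LINT x|lborel. bessel_integrand s (?A i) (B i) x)"
    unfolding fact by (simp only: integral_mult_right_zero lborel_PiM.product_integral_prod[OF finite_atLeastAtMost I])
  also have "(\<Prod>i\<in>{1..n+1}. LINT x|lborel. bessel_integrand s (?A i) (B i) x)
     = (\<Prod>i\<in>{1..n}. J i) * (Gamma s * exp (- s * of_real (ln (?A (n+1)))))"
  proof -
    have "(\<Prod>i\<in>{1..n}. LINT x|lborel. bessel_integrand s (?A i) (B i) x) = (\<Prod>i\<in>{1..n}. J i)"
      by (intro prod.cong) (auto simp: B_def J_def)
    moreover have "B (n+1) = 0" by (simp add: B_def)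
    ultimately show ?thesis using integral_bessel_gamma(2)[OF s left_weight_pos[of y u "n+1"]] by simp
  qed
  also have "exp ?a * ((\<Prod>i\<in>{1..n}. J i) * (Gamma s * exp (- s * of_real (ln (?A (n+1))))))
     = Gamma s * (exp (?a - s * of_real (ln (?A (n+1)))) * (\<Prod>i\<in>{1..n}. J i))"
    unfolding diff_conv_add_uminus[of ?a] exp_add by (simp only: mult_ac mult_minus_left)
  also have "?a - s * of_real (ln (?A (n+1))) = ?b + s * of_real (\<Sum>i=1..n. ln (?A i) - ln (right_weight y u i))"
  proof -
    have "complex_of_real (ln (?A (n+1))) = of_real (\<Sum>i=1..n+1. y i) + of_real (\<Sum>i=1..n. u i) - of_real (\<Sum>i=1..n. ln (?A i) - ln (right_weight y u i))"
      using arg_cong[OF sum_log_weights[of y u n], of complex_of_real] by (simp only: of_real_add) (simp add: algebra_simps)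
    thus ?thesis unfolding s_def by (elim ssubst) (simp only: ring_distribs, simp add: algebra_simps)
  qed
  also have "exp (?b + s * of_real (\<Sum>i=1..n. ln (?A i) - ln (right_weight y u i))) = exp ?b * (\<Prod>i\<in>{1..n}. E i)"
    unfolding E_def by (simp only: exp_add exp_sum[symmetric] finite_atLeastAtMost of_real_sum sum_distrib_left)
  also have "exp ?b * (\<Prod>i\<in>{1..n}. E i) * (\<Prod>i\<in>{1..n}. J i) = exp ?b * (\<Prod>i\<in>{1..n}. E i * J i)"
    by (simp add: prod.distrib)
  also have "(\<Prod>i\<in>{1..n}. E i * J i) = (\<Prod>i\<in>{1..n}. LINT v|lborel. bessel_integrand (- s) (?A i) (right_weight y u i) v)"
    unfolding E_def J_def by (intro prod.cong refl bessel_reflection[symmetric] left_weight_pos right_weight_pos)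
  finally show "(LINT x|lborel_Pi {1..n+1}. baxter_kernel n y x \<gamma> * givental_kernel n \<mu> x u)
      = Gamma s * (exp ?b * (\<Prod>i\<in>{1..n}. LINT v|lborel. bessel_integrand (- s) (?A i) (right_weight y u i) v))" .
qed

lemma integrable_givental_baxter:
  "integrable (lborel_Pi {1..Suc m}) (\<lambda>v. givental_kernel (Suc m) \<mu> y v * baxter_kernel m v u \<gamma>)"
  unfolding givental_baxter_factorization
  by (intro integrable_mult_right lborel_PiM.product_integrable_prod integrable_bessel left_weight_pos right_weight_pos) simp

text \<open>
  By the factorization of the right-hand integrand, its integral is the product of Bessel integrals
  in \<open>baxter_givental_integral\<close>.
\<close>

lemma baxter_givental_commute:
  assumes "Re (\<i> * \<gamma> - \<i> * \<mu>) > 0"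
  shows "(LINT x|lborel_Pi {1..Suc m+1}. baxter_kernel (Suc m) y x \<gamma> * givental_kernel (Suc m) \<mu> x u)
    = Gamma (\<i> * \<gamma> - \<i> * \<mu>) *
      (LINT v|lborel_Pi {1..Suc m}. givental_kernel (Suc m) \<mu> y v * baxter_kernel m v u \<gamma>)"
  unfolding baxter_givental_integral(2)[OF assms] givental_baxter_factorization
  by (simp only: integral_mult_right_zero
    lborel_PiM.product_integral_prod[OF finite_atLeastAtMost integrable_bessel[OF left_weight_pos right_weight_pos]])

lemma baxter_givental_0:
  assumes "Re (\<i> * \<gamma> - \<i> * \<mu>) > 0"
  shows "(LINT x|lborel_Pi {1..0+1}. baxter_kernel 0 y x \<gamma> * givental_kernel 0 \<mu> x u)
    = Gamma (\<i> * \<gamma> - \<i> * \<mu>) * givental_kernel 0 \<mu> y u"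
  unfolding baxter_givental_integral(2)[OF assms] by (simp add: givental_kernel_def)

text \<open>
  The absolute value of the kernel is the kernel with a purely imaginary parameter, so identities
  for the kernels carry over to their absolute values.
\<close>

lemma of_real_norm_baxter_kernel:
  "of_real (norm (baxter_kernel n y x \<gamma>)) = baxter_kernel n y x (\<i> * of_real (Im \<gamma>))"
  unfolding baxter_kernel_def norm_exp_eq_Re exp_of_real[symmetric]
  by (intro arg_cong[of _ _ exp]) (simp add: complex_eq_iff)

lemma of_real_norm_givental_kernel:
  "of_real (norm (givental_kernel n \<mu> x u)) = givental_kernel n (\<i> * of_real (Im \<mu>)) x u"
  unfolding givental_kernel_def norm_exp_eq_Re exp_of_real[symmetric]
  by (intro arg_cong[of _ _ exp]) (simp add: complex_eq_iff)

text \<open>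
  The previous two lemmas turn the absolute values into kernels with imaginary parameters, to which the
  complex relation applies with the positive number \<open>Re s\<close> in place of \<open>s\<close>.
\<close>

lemma nn_baxter_givental_commute:
  assumes "Re (\<i> * \<gamma> - \<i> * \<mu>) > 0"
  shows "(\<integral>\<^sup>+x. ennreal (norm (baxter_kernel (Suc m) y x \<gamma>)) * ennreal (norm (givental_kernel (Suc m) \<mu> x u)) \<partial>lborel_Pi {1..Suc m+1})
    = ennreal (Gamma (Re (\<i> * \<gamma> - \<i> * \<mu>))) *
      (\<integral>\<^sup>+v. ennreal (norm (givental_kernel (Suc m) \<mu> y v)) * ennreal (norm (baxter_kernel m v u \<gamma>)) \<partial>lborel_Pi {1..Suc m})"
proof -
  let ?\<gamma> = "\<i> * complex_of_real (Im \<gamma>)" and ?\<mu> = "\<i> * complex_of_real (Im \<mu>)"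
  let ?r = "Re (\<i> * \<gamma> - \<i> * \<mu>)"
  have r: "\<i> * ?\<gamma> - \<i> * ?\<mu> = of_real ?r" by (simp add: complex_eq_iff)
  have r0: "Re (\<i> * ?\<gamma> - \<i> * ?\<mu>) > 0" unfolding r using assms by simp
  let ?L = "LINT x|lborel_Pi {1..Suc m+1}. norm (baxter_kernel (Suc m) y x \<gamma> * givental_kernel (Suc m) \<mu> x u)"
  let ?R = "LINT v|lborel_Pi {1..Suc m}. norm (givental_kernel (Suc m) \<mu> y v * baxter_kernel m v u \<gamma>)"
  have "complex_of_real ?L = (LINT x|lborel_Pi {1..Suc m+1}. baxter_kernel (Suc m) y x ?\<gamma> * givental_kernel (Suc m) ?\<mu> x u)"
    unfolding integral_complex_of_real[symmetric] norm_mult of_real_mult of_real_norm_baxter_kernel of_real_norm_givental_kernel ..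
  also have "\<dots> = Gamma (of_real ?r) * (LINT v|lborel_Pi {1..Suc m}. givental_kernel (Suc m) ?\<mu> y v * baxter_kernel m v u ?\<gamma>)"
    unfolding baxter_givental_commute[OF r0] r ..
  also have "\<dots> = of_real (Gamma ?r * ?R)"
    unfolding of_real_mult integral_complex_of_real[symmetric] norm_mult of_real_norm_baxter_kernel of_real_norm_givental_kernel
      Gamma_complex_of_real ..
  finally have "?L = Gamma ?r * ?R" unfolding of_real_eq_iff .
  moreover have "?R \<ge> 0" by simp
  ultimately have "ennreal ?L = ennreal (Gamma ?r) * ennreal ?R"
    using assms by (simp only: ennreal_mult Gamma_real_pos less_imp_le)
  thus ?thesis
    by (simp only: ennreal_mult'[OF norm_ge_zero, symmetric] norm_mult[symmetric]
        nn_integral_eq_integral[OF integrable_norm[OF baxter_givental_integral(1)[OF assms]] AE_I2[OF norm_ge_zero]]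
        nn_integral_eq_integral[OF integrable_norm[OF integrable_givental_baxter] AE_I2[OF norm_ge_zero]])
qed

lemma nn_baxter_givental_0:
  assumes "Re (\<i> * \<gamma> - \<i> * \<mu>) > 0"
  shows "(\<integral>\<^sup>+x. ennreal (norm (baxter_kernel 0 y x \<gamma>)) * ennreal (norm (givental_kernel 0 \<mu> x u)) \<partial>lborel_Pi {1..0+1})
    = ennreal (Gamma (Re (\<i> * \<gamma> - \<i> * \<mu>))) * ennreal (norm (givental_kernel 0 \<mu> y u))"
proof -
  let ?\<gamma> = "\<i> * complex_of_real (Im \<gamma>)" and ?\<mu> = "\<i> * complex_of_real (Im \<mu>)"
  let ?r = "Re (\<i> * \<gamma> - \<i> * \<mu>)"
  have r: "\<i> * ?\<gamma> - \<i> * ?\<mu> = of_real ?r" by (simp add: complex_eq_iff)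
  have r0: "Re (\<i> * ?\<gamma> - \<i> * ?\<mu>) > 0" unfolding r using assms by simp
  let ?L = "LINT x|lborel_Pi {1..0+1}. norm (baxter_kernel 0 y x \<gamma> * givental_kernel 0 \<mu> x u)"
  let ?R = "norm (givental_kernel 0 \<mu> y u)"
  have "complex_of_real ?L = (LINT x|lborel_Pi {1..0+1}. baxter_kernel 0 y x ?\<gamma> * givental_kernel 0 ?\<mu> x u)"
    unfolding integral_complex_of_real[symmetric] norm_mult of_real_mult of_real_norm_baxter_kernel of_real_norm_givental_kernel ..
  also have "\<dots> = of_real (Gamma ?r * ?R)"
    unfolding baxter_givental_0[OF r0] r of_real_mult of_real_norm_givental_kernel Gamma_complex_of_real ..
  finally have "?L = Gamma ?r * ?R" unfolding of_real_eq_iff .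
  moreover have "?R \<ge> 0" by simp
  ultimately have "ennreal ?L = ennreal (Gamma ?r) * ennreal ?R"
    using assms by (simp only: ennreal_mult Gamma_real_pos less_imp_le)
  thus ?thesis
    by (simp only: ennreal_mult'[OF norm_ge_zero, symmetric] norm_mult[symmetric]
        nn_integral_eq_integral[OF integrable_norm[OF baxter_givental_integral(1)[OF assms]] AE_I2[OF norm_ge_zero]])
qed

section \<open>The eigenvalue equation on the half-plane of convergence\<close>

lemma abs_whittaker_finite: "abs_whittaker l \<Lambda> x < \<infinity>"
  using abs_whittaker_growth[of l \<Lambda>] by (metis ennreal_less_top infinity_ennreal_def order_le_less_trans)

lemma measurable_lborel_Pi_comp:
  assumes "f \<in> M \<rightarrow>\<^sub>M lborel_Pi I" "i \<in> I"
  shows "(\<lambda>w. f w i) \<in> borel_measurable M"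
  using measurable_compose[OF assms(1) measurable_lborel_Pi_component[OF assms(2)]] .

lemma measurable_baxter_kernel [measurable (raw)]:
  assumes "g \<in> M \<rightarrow>\<^sub>M lborel_Pi {1..l+1}"
  shows "(\<lambda>w. baxter_kernel l y (g w) \<gamma>) \<in> borel_measurable M"
  by (intro borel_measurable_baxter_kernel measurable_lborel_Pi_comp[OF assms]) auto

lemma measurable_baxter_kernel2 [measurable (raw)]:
  assumes "f \<in> M \<rightarrow>\<^sub>M lborel_Pi {1..l+1}" "g \<in> M \<rightarrow>\<^sub>M lborel_Pi {1..l+1}"
  shows "(\<lambda>w. baxter_kernel l (f w) (g w) \<gamma>) \<in> borel_measurable M"
  by (intro borel_measurable_baxter_kernel measurable_lborel_Pi_comp[OF assms(1)] measurable_lborel_Pi_comp[OF assms(2)])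

lemma measurable_givental_kernel [measurable (raw)]:
  assumes "g \<in> M \<rightarrow>\<^sub>M lborel_Pi {1..m+1}"
  shows "(\<lambda>w. givental_kernel (Suc m) \<mu> y (g w)) \<in> borel_measurable M"
  by (intro borel_measurable_givental_kernel measurable_lborel_Pi_comp[OF assms]) auto

lemma measurable_givental_kernel2 [measurable (raw)]:
  assumes "f \<in> M \<rightarrow>\<^sub>M lborel_Pi {1..Suc m+1}" "g \<in> M \<rightarrow>\<^sub>M lborel_Pi {1..m+1}"
  shows "(\<lambda>w. givental_kernel (Suc m) \<mu> (f w) (g w)) \<in> borel_measurable M"
  by (intro borel_measurable_givental_kernel measurable_lborel_Pi_comp[OF assms(1)] measurable_lborel_Pi_comp[OF assms(2)]) auto

text \<open>
  The eigenvalue equation for the absolute values. All integrands are nonnegative, so the intertwining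
  relation can be applied under the integral over \<open>u\<close> by Tonelli's theorem alone.
\<close>

lemma abs_baxter_whittaker:
  assumes "\<And>j. j \<in> {1..l+1} \<Longrightarrow> Re (\<i> * \<gamma> - \<i> * \<Lambda> j) > 0"
  shows "(\<integral>\<^sup>+x. ennreal (norm (baxter_kernel l y x \<gamma>)) * abs_whittaker l \<Lambda> x \<partial>lborel_Pi {1..l+1})
    = (\<Prod>j=1..l+1. ennreal (Gamma (Re (\<i> * \<gamma> - \<i> * \<Lambda> j)))) * abs_whittaker l \<Lambda> y"
  using assms
proof (induction l arbitrary: y)
  case 0
  show ?case
    unfolding abs_whittaker_0[of _ _ "\<lambda>_. 0"] using nn_baxter_givental_0[of \<gamma> "\<Lambda> 1" y "\<lambda>_. 0"] 0 by simp
next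
  case (Suc m)
  let ?X = "lborel_Pi {1..Suc m+1}" and ?V = "lborel_Pi {1..m+1}"
  let ?Q = "\<lambda>l y x. ennreal (norm (baxter_kernel l y x \<gamma>))"
  let ?K = "\<lambda>x u. ennreal (norm (givental_kernel (Suc m) (\<Lambda> (m+2)) x u))"
  let ?W = "abs_whittaker m \<Lambda>"
  let ?G = "ennreal (Gamma (Re (\<i> * \<gamma> - \<i> * \<Lambda> (m+2))))"
  let ?P = "\<Prod>j=1..m+1. ennreal (Gamma (Re (\<i> * \<gamma> - \<i> * \<Lambda> j)))"
  have V: "lborel_Pi {1..Suc m} = lborel_Pi {1..m+1}" by simp
  have s: "Re (\<i> * \<gamma> - \<i> * \<Lambda> (m+2)) > 0" using Suc.prems[of "m+2"] by simp
  interpret XV: pair_sigma_finite ?X ?V by (intro pair_sigma_finite_lborel_Pi) auto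
  interpret VV: pair_sigma_finite ?V ?V by (intro pair_sigma_finite_lborel_Pi) auto
  have [measurable]: "?W \<in> borel_measurable ?V" by (rule measurable_abs_whittaker)
  have "(\<integral>\<^sup>+x. ?Q (Suc m) y x * abs_whittaker (Suc m) \<Lambda> x \<partial>?X)
      = (\<integral>\<^sup>+x. \<integral>\<^sup>+u. ?Q (Suc m) y x * ?K x u * ?W u \<partial>?V \<partial>?X)"
    unfolding abs_whittaker_Suc mult.assoc by (intro nn_integral_cong nn_integral_cmult[symmetric]) measurable
  also have "\<dots> = (\<integral>\<^sup>+u. \<integral>\<^sup>+x. ?Q (Suc m) y x * ?K x u * ?W u \<partial>?X \<partial>?V)"
    by (rule XV.Fubini'[symmetric]) (unfold case_prod_beta, measurable)
  also have "\<dots> = (\<integral>\<^sup>+u. (\<integral>\<^sup>+x. ?Q (Suc m) y x * ?K x u \<partial>?X) * ?W u \<partial>?V)"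
    by (intro nn_integral_cong nn_integral_multc) measurable
  also have "\<dots> = (\<integral>\<^sup>+u. ?G * (\<integral>\<^sup>+v. ?K y v * ?Q m v u * ?W u \<partial>?V) \<partial>?V)"
  proof (rule nn_integral_cong)
    fix u assume u: "u \<in> space ?V"
    have "(\<integral>\<^sup>+x. ?Q (Suc m) y x * ?K x u \<partial>?X) * ?W u = ?G * ((\<integral>\<^sup>+v. ?K y v * ?Q m v u \<partial>?V) * ?W u)"
      unfolding nn_baxter_givental_commute[OF s, where m = m, unfolded V] by (rule mult.assoc)
    also have "(\<integral>\<^sup>+v. ?K y v * ?Q m v u \<partial>?V) * ?W u = (\<integral>\<^sup>+v. ?K y v * ?Q m v u * ?W u \<partial>?V)"
      by (rule nn_integral_multc[symmetric]) (use u in measurable)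
    finally show "(\<integral>\<^sup>+x. ?Q (Suc m) y x * ?K x u \<partial>?X) * ?W u = ?G * (\<integral>\<^sup>+v. ?K y v * ?Q m v u * ?W u \<partial>?V)" .
  qed
  also have "\<dots> = ?G * (\<integral>\<^sup>+u. \<integral>\<^sup>+v. ?K y v * ?Q m v u * ?W u \<partial>?V \<partial>?V)"
    by (rule nn_integral_cmult) measurable
  also have "(\<integral>\<^sup>+u. \<integral>\<^sup>+v. ?K y v * ?Q m v u * ?W u \<partial>?V \<partial>?V) = (\<integral>\<^sup>+v. \<integral>\<^sup>+u. ?K y v * ?Q m v u * ?W u \<partial>?V \<partial>?V)"
    by (rule VV.Fubini') (unfold case_prod_beta, measurable)
  also have "\<dots> = (\<integral>\<^sup>+v. ?K y v * (\<integral>\<^sup>+u. ?Q m v u * ?W u \<partial>?V) \<partial>?V)"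
    unfolding mult.assoc by (intro nn_integral_cong nn_integral_cmult) measurable
  also have "\<dots> = (\<integral>\<^sup>+v. ?P * (?K y v * ?W v) \<partial>?V)"
    using Suc.IH Suc.prems by (simp add: mult_ac)
  also have "\<dots> = ?P * abs_whittaker (Suc m) \<Lambda> y"
    unfolding abs_whittaker_Suc by (rule nn_integral_cmult) measurable
  finally show ?case by (simp add: mult_ac)
qed

lemma abs_baxter_whittaker_finite:
  assumes "\<And>j. j \<in> {1..l+1} \<Longrightarrow> Re (\<i> * \<gamma> - \<i> * \<Lambda> j) > 0"
  shows "(\<integral>\<^sup>+x. ennreal (norm (baxter_kernel l y x \<gamma>)) * abs_whittaker l \<Lambda> x \<partial>lborel_Pi {1..l+1}) < \<infinity>"
proof -
  have "(\<Prod>j=1..l+1. ennreal (Gamma (Re (\<i> * \<gamma> - \<i> * \<Lambda> j))))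
      = ennreal (\<Prod>j=1..l+1. Gamma (Re (\<i> * \<gamma> - \<i> * \<Lambda> j)))"
    using assms by (intro prod_ennreal) (auto intro!: less_imp_le Gamma_real_pos simp del: prod.cl_ivl_Suc)
  note prod_eq = this
  have "(\<integral>\<^sup>+x. ennreal (norm (baxter_kernel l y x \<gamma>)) * abs_whittaker l \<Lambda> x \<partial>lborel_Pi {1..l+1})
      = ennreal (\<Prod>j=1..l+1. Gamma (Re (\<i> * \<gamma> - \<i> * \<Lambda> j))) * abs_whittaker l \<Lambda> y"
    unfolding prod_eq[symmetric] by (rule abs_baxter_whittaker[OF assms])
  also have "\<dots> < \<infinity>"
    using abs_whittaker_finite[of l \<Lambda> y] by (simp only: infinity_ennreal_def ennreal_mult_less_top ennreal_less_top simp_thms)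
  finally show ?thesis .
qed

lemma integrable_baxter_whittaker:
  assumes "\<And>j. j \<in> {1..l+1} \<Longrightarrow> Re (\<i> * \<gamma> - \<i> * \<Lambda> j) > 0"
  shows "integrable (lborel_Pi {1..l+1}) (\<lambda>x. baxter_kernel l y x \<gamma> * whittaker l \<Lambda> x)"
proof (rule integrableI_bounded)
  show "(\<lambda>x. baxter_kernel l y x \<gamma> * whittaker l \<Lambda> x) \<in> borel_measurable (lborel_Pi {1..l+1})"
    by measurable
  have "(\<integral>\<^sup>+x. ennreal (norm (baxter_kernel l y x \<gamma> * whittaker l \<Lambda> x)) \<partial>lborel_Pi {1..l+1})
     \<le> (\<integral>\<^sup>+x. ennreal (norm (baxter_kernel l y x \<gamma>)) * abs_whittaker l \<Lambda> x \<partial>lborel_Pi {1..l+1})"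
    unfolding norm_mult ennreal_mult'[OF norm_ge_zero]
    by (intro nn_integral_mono mult_left_mono norm_whittaker_le) simp
  also have "\<dots> < \<infinity>" by (rule abs_baxter_whittaker_finite[OF assms])
  finally show "(\<integral>\<^sup>+x. ennreal (norm (baxter_kernel l y x \<gamma> * whittaker l \<Lambda> x)) \<partial>lborel_Pi {1..l+1}) < \<infinity>" .
qed

text \<open>
  The Baxter operator is moved past the outermost row by the intertwining relation, at the cost of one Gamma
  factor, and then acts on the Whittaker function of smaller rank. Both applications of Fubini's
  theorem rest on \<open>abs_baxter_whittaker\<close>.
\<close>

lemma baxter_whittaker_half_plane:
  assumes "\<And>j. j \<in> {1..l+1} \<Longrightarrow> Re (\<i> * \<gamma> - \<i> * \<Lambda> j) > 0"
  shows "(LINT x|lborel_Pi {1..l+1}. baxter_kernel l y x \<gamma> * whittaker l \<Lambda> x)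
    = (\<Prod>i=1..l+1. Gamma (\<i> * \<gamma> - \<i> * \<Lambda> i)) * whittaker l \<Lambda> y"
  using assms
proof (induction l arbitrary: y)
  case 0
  show ?case
    unfolding whittaker_0[of _ _ "\<lambda>_. 0"] using baxter_givental_0[of \<gamma> "\<Lambda> 1" y "\<lambda>_. 0"] 0 by simp
next
  case (Suc m)
  let ?X = "lborel_Pi {1..Suc m+1}" and ?V = "lborel_Pi {1..m+1}"
  let ?Q = "\<lambda>l y x. baxter_kernel l y x \<gamma>"
  let ?K = "\<lambda>x u. givental_kernel (Suc m) (\<Lambda> (m+2)) x u"
  let ?W = "whittaker m \<Lambda>" and ?aW = "abs_whittaker m \<Lambda>"
  let ?G = "Gamma (\<i> * \<gamma> - \<i> * \<Lambda> (m+2))"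
  let ?P = "\<Prod>j=1..m+1. Gamma (\<i> * \<gamma> - \<i> * \<Lambda> j)"
  have V: "lborel_Pi {1..Suc m} = lborel_Pi {1..m+1}" by simp
  have s: "Re (\<i> * \<gamma> - \<i> * \<Lambda> (m+2)) > 0" using Suc.prems[of "m+2"] by simp
  interpret XV: pair_sigma_finite ?X ?V by (intro pair_sigma_finite_lborel_Pi) auto
  interpret VV: pair_sigma_finite ?V ?V by (intro pair_sigma_finite_lborel_Pi) auto
  have [measurable]: "?W \<in> borel_measurable ?V" "?aW \<in> borel_measurable ?V"
    by (rule measurable_whittaker measurable_abs_whittaker)+
  \<comment> \<open>before the kernels are exchanged: Baxter kernel of rank \<open>m + 1\<close> outside\<close>
  have I1: "integrable (?X \<Otimes>\<^sub>M ?V) (\<lambda>(x, u). ?Q (Suc m) y x * (?K x u * ?W u))"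
  proof (rule integrableI_bounded)
    show meas: "(\<lambda>(x, u). ?Q (Suc m) y x * (?K x u * ?W u)) \<in> borel_measurable (?X \<Otimes>\<^sub>M ?V)"
      unfolding case_prod_beta by measurable
    have nmeas: "(\<lambda>z. ennreal (norm (case z of (x, u) \<Rightarrow> ?Q (Suc m) y x * (?K x u * ?W u)))) \<in> borel_measurable (?X \<Otimes>\<^sub>M ?V)"
      by (rule measurable_compose[OF meas]) measurable
    have "(\<integral>\<^sup>+z. ennreal (norm (case z of (x, u) \<Rightarrow> ?Q (Suc m) y x * (?K x u * ?W u))) \<partial>(?X \<Otimes>\<^sub>M ?V))
       = (\<integral>\<^sup>+x. \<integral>\<^sup>+u. ennreal (norm (?Q (Suc m) y x * (?K x u * ?W u))) \<partial>?V \<partial>?X)"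
      by (simp only: XV.M2.nn_integral_fst[OF nmeas, symmetric] prod.case)
    also have "\<dots> \<le> (\<integral>\<^sup>+x. ennreal (norm (?Q (Suc m) y x)) * abs_whittaker (Suc m) \<Lambda> x \<partial>?X)"
    proof (rule nn_integral_mono)
      fix x
      have "(\<integral>\<^sup>+u. ennreal (norm (?Q (Suc m) y x * (?K x u * ?W u))) \<partial>?V)
         \<le> (\<integral>\<^sup>+u. ennreal (norm (?Q (Suc m) y x)) * (ennreal (norm (?K x u)) * ?aW u) \<partial>?V)"
        unfolding norm_mult ennreal_mult'[OF norm_ge_zero]
        by (intro nn_integral_mono mult_left_mono norm_whittaker_le) auto
      also have "\<dots> = ennreal (norm (?Q (Suc m) y x)) * abs_whittaker (Suc m) \<Lambda> x"
        unfolding abs_whittaker_Suc by (rule nn_integral_cmult) measurable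
      finally show "(\<integral>\<^sup>+u. ennreal (norm (?Q (Suc m) y x * (?K x u * ?W u))) \<partial>?V)
         \<le> ennreal (norm (?Q (Suc m) y x)) * abs_whittaker (Suc m) \<Lambda> x" .
    qed
    also have "\<dots> < \<infinity>" by (rule abs_baxter_whittaker_finite[OF Suc.prems])
    finally show "(\<integral>\<^sup>+z. ennreal (norm (case z of (x, u) \<Rightarrow> ?Q (Suc m) y x * (?K x u * ?W u))) \<partial>(?X \<Otimes>\<^sub>M ?V)) < \<infinity>" .
  qed
  \<comment> \<open>after the exchange: Baxter kernel of rank \<open>m\<close> inside\<close>
  have I2: "integrable (?V \<Otimes>\<^sub>M ?V) (\<lambda>(v, u). ?K y v * (?Q m v u * ?W u))"
  proof (rule integrableI_bounded)
    show meas: "(\<lambda>(v, u). ?K y v * (?Q m v u * ?W u)) \<in> borel_measurable (?V \<Otimes>\<^sub>M ?V)"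
      unfolding case_prod_beta by measurable
    have nmeas: "(\<lambda>z. ennreal (norm (case z of (v, u) \<Rightarrow> ?K y v * (?Q m v u * ?W u)))) \<in> borel_measurable (?V \<Otimes>\<^sub>M ?V)"
      by (rule measurable_compose[OF meas]) measurable
    let ?C = "\<Prod>j=1..m+1. ennreal (Gamma (Re (\<i> * \<gamma> - \<i> * \<Lambda> j)))"
    have prems: "\<And>j. j \<in> {1..m+1} \<Longrightarrow> Re (\<i> * \<gamma> - \<i> * \<Lambda> j) > 0" using Suc.prems by simp
    have IH_abs: "(\<integral>\<^sup>+u. ennreal (norm (?Q m v u)) * ?aW u \<partial>?V) = ?C * ?aW v" for v
      by (rule abs_baxter_whittaker) (rule prems)
    have "(\<integral>\<^sup>+z. ennreal (norm (case z of (v, u) \<Rightarrow> ?K y v * (?Q m v u * ?W u))) \<partial>(?V \<Otimes>\<^sub>M ?V))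
       = (\<integral>\<^sup>+v. \<integral>\<^sup>+u. ennreal (norm (?K y v * (?Q m v u * ?W u))) \<partial>?V \<partial>?V)"
      by (simp only: XV.M2.nn_integral_fst[OF nmeas, symmetric] prod.case)
    also have "\<dots> \<le> (\<integral>\<^sup>+v. ?C * (ennreal (norm (?K y v)) * ?aW v) \<partial>?V)"
    proof (rule nn_integral_mono)
      fix v
      have "(\<integral>\<^sup>+u. ennreal (norm (?K y v * (?Q m v u * ?W u))) \<partial>?V)
         \<le> (\<integral>\<^sup>+u. ennreal (norm (?K y v)) * (ennreal (norm (?Q m v u)) * ?aW u) \<partial>?V)"
        unfolding norm_mult ennreal_mult'[OF norm_ge_zero]
        by (intro nn_integral_mono mult_left_mono norm_whittaker_le) auto
      also have "\<dots> = ennreal (norm (?K y v)) * (?C * ?aW v)"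
        unfolding IH_abs[symmetric] by (rule nn_integral_cmult) measurable
      finally show "(\<integral>\<^sup>+u. ennreal (norm (?K y v * (?Q m v u * ?W u))) \<partial>?V)
         \<le> ?C * (ennreal (norm (?K y v)) * ?aW v)" by (simp only: mult_ac)
    qed
    also have "\<dots> = ?C * abs_whittaker (Suc m) \<Lambda> y"
      unfolding abs_whittaker_Suc by (rule nn_integral_cmult) measurable
    also have "?C = ennreal (\<Prod>j=1..m+1. Gamma (Re (\<i> * \<gamma> - \<i> * \<Lambda> j)))"
      using prems by (intro prod_ennreal less_imp_le Gamma_real_pos)
    also have "\<dots> * abs_whittaker (Suc m) \<Lambda> y < \<infinity>"
      using abs_whittaker_finite[of "Suc m" \<Lambda> y]
      by (simp only: infinity_ennreal_def ennreal_mult_less_top ennreal_less_top simp_thms)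
    finally show "(\<integral>\<^sup>+z. ennreal (norm (case z of (v, u) \<Rightarrow> ?K y v * (?Q m v u * ?W u))) \<partial>(?V \<Otimes>\<^sub>M ?V)) < \<infinity>" .
  qed
  note rec = whittaker_Suc[OF abs_whittaker_finite]
  have "(LINT x|?X. ?Q (Suc m) y x * whittaker (Suc m) \<Lambda> x)
      = (LINT x|?X. LINT u|?V. ?Q (Suc m) y x * (?K x u * ?W u))"
    unfolding rec by (simp only: integral_mult_right_zero)
  also have "\<dots> = (LINT u|?V. LINT x|?X. ?Q (Suc m) y x * (?K x u * ?W u))"
    by (rule XV.Fubini_integral[OF I1, symmetric])
  also have "\<dots> = (LINT u|?V. ?G * (LINT v|?V. ?K y v * (?Q m v u * ?W u)))"
    unfolding mult.assoc[symmetric] integral_mult_left_zero baxter_givental_commute[OF s, where m = m, unfolded V] ..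
  also have "\<dots> = ?G * (LINT u|?V. LINT v|?V. ?K y v * (?Q m v u * ?W u))"
    by (rule integral_mult_right_zero)
  also have "(LINT u|?V. LINT v|?V. ?K y v * (?Q m v u * ?W u)) = (LINT v|?V. LINT u|?V. ?K y v * (?Q m v u * ?W u))"
    by (rule VV.Fubini_integral[OF I2])
  also have "\<dots> = (LINT v|?V. ?P * (?K y v * ?W v))"
  proof -
    have IH: "(LINT u|?V. ?Q m v u * ?W u) = ?P * ?W v" for v
      by (rule Suc.IH) (use Suc.prems in simp)
    have "(LINT v|?V. LINT u|?V. ?K y v * (?Q m v u * ?W u)) = (LINT v|?V. ?K y v * (?P * ?W v))"
      by (simp only: integral_mult_right_zero IH)
    thus ?thesis by (simp only: mult.left_commute)
  qed
  also have "\<dots> = ?P * whittaker (Suc m) \<Lambda> y"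
    unfolding rec by (rule integral_mult_right_zero)
  finally show ?case by (simp add: mult_ac)
qed


section \<open>Removing the restriction on the parameters\<close>

lemma baxter_kernel_shift:
  "baxter_kernel l y x (\<gamma> - \<i> * z) = exp (z * of_real (\<Sum>i=1..l+1. y i - x i)) * baxter_kernel l y x \<gamma>"
proof -
  have "\<i> * (\<gamma> - \<i> * z) = z + \<i> * \<gamma>" by (simp add: algebra_simps)
  thus ?thesis unfolding baxter_kernel_def exp_add[symmetric]
    by (simp only: distrib_right add_diff_eq)
qed

theorem corollary2p2:
  fixes l :: nat and \<gamma> :: complex and \<Lambda> :: "nat \<Rightarrow> complex" and y :: "nat \<Rightarrow> real"
  assumes "integrable (lborel_Pi {1..l+1}) (\<lambda>x. baxter_kernel l y x \<gamma> * whittaker l \<Lambda> x)"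
  shows "(LINT x|lborel_Pi {1..l+1}. baxter_kernel l y x \<gamma> * whittaker l \<Lambda> x)
    = (\<Prod>i=1..l+1. Gamma (\<i> * \<gamma> - \<i> * \<Lambda> i)) * whittaker l \<Lambda> y"
proof -
  define S where "S x = (\<Sum>i=1..l+1. y i - x i)" for x :: "nat \<Rightarrow> real"
  define g where "g x = baxter_kernel l y x \<gamma> * whittaker l \<Lambda> x" for x
  \<comment> \<open>beyond \<open>T\<close> the shifted parameter lies in the half-plane of the previous section\<close>
  define T where "T = (\<Sum>j=1..l+1. \<bar>Re (\<i> * \<gamma> - \<i> * \<Lambda> j)\<bar>) + 1"
  define s where "s j = \<i> * \<gamma> - \<i> * \<Lambda> j" for j
  have S_meas: "S \<in> borel_measurable (lborel_Pi {1..l+1})"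
    unfolding S_def[abs_def]
    by (intro borel_measurable_sum borel_measurable_diff borel_measurable_const measurable_lborel_Pi_component)
  have g_int: "integrable (lborel_Pi {1..l+1}) g"
    using assms unfolding g_def[abs_def] .
  have shift: "exp (z * of_real (S x)) * g x = baxter_kernel l y x (\<gamma> - \<i> * z) * whittaker l \<Lambda> x" for z x
    unfolding g_def S_def baxter_kernel_shift by (simp only: mult.assoc)
  have shifted: "\<i> * (\<gamma> - \<i> * z) - \<i> * \<Lambda> j = s j + z" for z j
    by (simp add: s_def algebra_simps)
  have T: "Re (\<i> * (\<gamma> - \<i> * z) - \<i> * \<Lambda> j) > 0" if "j \<in> {1..l+1}" "Re z \<ge> T" for z j
  proof -
    have "\<bar>Re (s j)\<bar> \<le> (\<Sum>j=1..l+1. \<bar>Re (s j)\<bar>)"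
      using that by (intro member_le_sum) auto
    thus ?thesis using that unfolding shifted T_def s_def[symmetric] by simp
  qed
  have g_exp_int: "integrable (lborel_Pi {1..l+1}) (\<lambda>x. of_real (exp (t * S x)) * g x)" if "t \<ge> T" for t
  proof -
    have "of_real (exp (t * S x)) * g x = exp (of_real t * of_real (S x)) * g x" for x
      by (simp add: exp_of_real[symmetric])
    moreover have "integrable (lborel_Pi {1..l+1}) (\<lambda>x. baxter_kernel l y x (\<gamma> - \<i> * of_real t) * whittaker l \<Lambda> x)"
      using that by (intro integrable_baxter_whittaker T) simp_all
    ultimately show ?thesis by (simp only: shift)
  qed
  have "(LINT x|lborel_Pi {1..l+1}. baxter_kernel l y x (\<gamma> - \<i> * z) * whittaker l \<Lambda> x)
      = (\<Prod>i=1..l+1. Gamma (\<i> * (\<gamma> - \<i> * z) - \<i> * \<Lambda> i)) * whittaker l \<Lambda> y" if "Re z > T" for z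
    using that by (intro baxter_whittaker_half_plane T) simp_all
  hence large: "(LINT x|lborel_Pi {1..l+1}. exp (z * of_real (S x)) * g x)
      = (\<Prod>i=1..l+1. Gamma (s i + z)) * whittaker l \<Lambda> y" if "Re z > T" for z
    using that unfolding shift shifted by simp
  note continuation = laplace_continuation[OF S_meas g_int g_exp_int]
  let ?R = "\<lambda>z. \<Prod>i=1..l+1. rGamma (s i + z)"
  have R: "(LINT x|lborel_Pi {1..l+1}. g x) * ?R 0 = whittaker l \<Lambda> y"
  proof (rule continuation)
    show "?R holomorphic_on UNIV" by (intro holomorphic_intros)
    fix z assume z: "Re z > T"
    have "rGamma (s i + z) \<noteq> 0" if "i \<in> {1..l+1}" for i
    proof -
      have "Re (s i + z) > 0" using T[OF that, of z] z unfolding shifted by simp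
      hence "s i + z \<notin> \<int>\<^sub>\<le>\<^sub>0" by (metis nonpos_Ints_cases Re_complex_of_real of_real_of_int_eq not_less of_int_le_0_iff)
      thus ?thesis by (simp add: rGamma_eq_zero_iff)
    qed
    hence "?R z \<noteq> 0" by (simp del: prod.cl_ivl_Suc)
    moreover have "(\<Prod>i=1..l+1. Gamma (s i + z)) = inverse (?R z)"
      by (simp only: Gamma_def prod_inversef[symmetric] comp_def)
    ultimately show "(LINT x|lborel_Pi {1..l+1}. exp (z * of_real (S x)) * g x) * ?R z = whittaker l \<Lambda> y"
      unfolding large[OF z] by (simp del: prod.cl_ivl_Suc)
  qed
  have G: "(\<Prod>i=1..l+1. Gamma (s i)) = inverse (?R 0)"
    by (simp only: Gamma_def prod_inversef[symmetric] comp_def add_0_right)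
  \<comment> \<open>as \<open>Gamma\<close> is \<open>0\<close> at its poles, the right-hand side vanishes if some \<open>s i\<close> is a pole\<close>
  have "(LINT x|lborel_Pi {1..l+1}. g x) = (\<Prod>i=1..l+1. Gamma (s i)) * whittaker l \<Lambda> y"
  proof (cases "?R 0 = 0")
    case False
    thus ?thesis unfolding G R[symmetric] by (simp del: prod.cl_ivl_Suc)
  next
    case True
    \<comment> \<open>then \<open>whittaker l \<Lambda> y = 0\<close>, so the integral is \<open>0\<close> for large \<open>Re z\<close> and hence at \<open>z = 0\<close>\<close>
    hence W0: "whittaker l \<Lambda> y = 0" using R by (metis mult_zero_right)
    have "(LINT x|lborel_Pi {1..l+1}. g x) * 1 = 0"
    proof (rule continuation[where R = "\<lambda>_. 1"])
      fix z assume "Re z > T"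
      thus "(LINT x|lborel_Pi {1..l+1}. exp (z * of_real (S x)) * g x) * 1 = 0"
        by (simp only: large W0 mult_zero_right mult_1_right)
    qed simp_all
    thus ?thesis by (simp add: W0)
  qed
  thus ?thesis unfolding g_def s_def .
qed

end
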